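(* Let $K$ be a field, let $\mathcal{O}\subset\mathbb{T}^n$ be a (nonempty) order ideal and $\sigma$ a term ordering on $\mathbb{T}^n$. Consider the following conditions. $a_1)$ The canonical embedding of $K[S_{c\mathcal{O},\sigma}]$ in $K[c_{11},\dots,c_{\mu\nu}]$ induces an isomorphism between $G_{\mathcal{O},\sigma}$ and $B_{\mathcal{O}}$. $a_2)$ The canonical embedding of $K[\mathbf{x},S_{c\mathcal{O},\sigma}]$ in $K[\mathbf{x},c_{11},\dots,c_{\mu\nu}]$ induces an isomorphism between $U_{\mathcal{O},\sigma}$ and $U_{\mathcal{O}}$. $b_1)$ The ideal $L_{\mathcal{O},\sigma}$ is the zero ideal. $b_2)$ The order ideal $\mathcal{O}$ is a $\sigma$-cornercut, i.e. $b>_\sigma t$ for every $b\in c\mathcal{O}$ and every $t\in\mathcal{O}$. Then $a_1)$ is equivalent to $a_2)$, $b_1)$ is equivalent to $b_2)$, and $b_1)$ implies $a_1)$.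
   Context: Notation: $\mathbf{x}=x_1,\dots,x_n$, $\mathbb{T}^n=\{x_1^{\alpha_1}\cdots x_n^{\alpha_n}\mid\alpha_i\ge0\}$. An order ideal is a finite set $\mathcal{O}=\{t_1,\dots,t_\mu\}\subset\mathbb{T}^n$ (here nonempty) closed under taking divisors. Its border is $\partial\mathcal{O}=(x_1\mathcal{O}\cup\dots\cup x_n\mathcal{O})\setminus\mathcal{O}=\{b_1,\dots,b_\nu\}$. The corners $c\mathcal{O}\subseteq\partial\mathcal{O}$ are the minimal generators of the monoid ideal $\mathbb{T}^n\setminus\mathcal{O}$; the labelling is chosen so that $c\mathcal{O}=\{b_1,\dots,b_\eta\}$, $\eta\le\nu$. Let $\mathbf{c}=\{c_{ij}\mid 1\le i\le\mu,1\le j\le\nu\}$ be new indeterminates. Generic border prebasis: $g_j=b_j-\sum_{i=1}^\mu c_{ij}t_i$ for $j=1,\dots,\nu$. For $k=1,\dots,n$ the generic multiplication matrix $\mathcal{A}_k\in\mathrm{Mat}_\mu(K[\mathbf{c}])$ has $(i,j)$ entry $\delta_{im}$ if $x_kt_j=t_m\in\mathcal{O}$, and $c_{im}$ if $x_kt_j=b_m\in\partial\mathcal{O}$. $I(\mathbb{B}_{\mathcal{O}})\subseteq K[\mathbf{c}]$ is the ideal generated by all entries of all $\mathcal{A}_k\mathcal{A}_\ell-\mathcal{A}_\ell\mathcal{A}_k$, $1\le k<\ell\le n$; $B_{\mathcal{O}}=K[\mathbf{c}]/I(\mathbb{B}_{\mathcal{O}})$; $U_{\mathcal{O}}=K[\mathbf{x},\mathbf{c}]/(I(\mathbb{B}_{\mathcal{O}})+(g_1,\dots,g_\nu))$.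 $S_{\mathcal{O},\sigma}=\{c_{ij}\mid b_j>_\sigma t_i\}$; $L_{\mathcal{O},\sigma}$ is the ideal of $K[\mathbf{c}]$ generated by the $c_{ij}\notin S_{\mathcal{O},\sigma}$; $S_{c\mathcal{O},\sigma}=\{c_{ij}\in S_{\mathcal{O},\sigma}\mid j\le\eta\}$. For $j=1,\dots,\eta$ let $g_j^*=b_j-\sum_{\{i\mid b_j>_\sigma t_i\}}c_{ij}t_i$. $I(\mathbb{G}_{\mathcal{O},\sigma})=(L_{\mathcal{O},\sigma}+I(\mathbb{B}_{\mathcal{O}}))\cap K[S_{c\mathcal{O},\sigma}]$; $G_{\mathcal{O},\sigma}=K[S_{c\mathcal{O},\sigma}]/I(\mathbb{G}_{\mathcal{O},\sigma})$; $U_{\mathcal{O},\sigma}=K[\mathbf{x},S_{c\mathcal{O},\sigma}]/(I(\mathbb{G}_{\mathcal{O},\sigma})+(g_1^*,\dots,g_\eta^* ))$. "An embedding of polynomial rings induces an isomorphism between the quotients" means that it maps the ideal defining the first quotient into the ideal defining the second, and that the resulting homomorphism of quotient rings is an isomorphism. *)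

theory Defs
  imports
    "Jordan_Normal_Form.Matrix"
    "HOL-Library.Poly_Mapping"
    "HOL-Algebra.QuotRing"
begin

text \<open>
  All polynomial rings live inside one ring with the indeterminates \<open>X k\<close> and \<open>C i j\<close>, so that
  the canonical embeddings between them are inclusions. All labels start at 0: the paper's
  $x_k$, $c_{ij}$, $t_i$, $b_j$ are \<open>X (k-1)\<close>, \<open>C (i-1) (j-1)\<close>, \<open>ts ! (i-1)\<close>, \<open>bs ! (j-1)\<close>,
  where the lists \<open>ts\<close> and \<open>bs\<close> are the chosen labellings of the order ideal and of its border.
\<close>

datatype indet = X nat | C nat nat

type_synonym pp = "indet \<Rightarrow>\<^sub>0 nat"

type_synonym 'a mpoly = "pp \<Rightarrow>\<^sub>0 'a"

definition xvar :: "nat \<Rightarrow> pp" where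
  "xvar k = Poly_Mapping.single (X k) 1"

definition mon :: "pp \<Rightarrow> 'a::field mpoly" where
  "mon t = Poly_Mapping.single t 1"

definition cvar :: "nat \<Rightarrow> nat \<Rightarrow> 'a::field mpoly" where
  "cvar i j = mon (Poly_Mapping.single (C i j) 1)"


section \<open>Polynomial rings and their quotients\<close>

definition poly_ring :: "indet set \<Rightarrow> 'a::field mpoly ring" where
  "poly_ring V = \<lparr>carrier = {p. \<forall>m\<in>Poly_Mapping.keys p. Poly_Mapping.keys m \<subseteq> V},
     mult = (*), one = 1, zero = 0, add = (+)\<rparr>"

lemma cring_poly_ring: "cring (poly_ring V :: 'a::field mpoly ring)"
proof -
  let ?P = "\<lambda>p :: 'a mpoly. \<forall>m\<in>Poly_Mapping.keys p. Poly_Mapping.keys m \<subseteq> V"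
  have add: "?P (p + q)" if "?P p" "?P q" for p q
    using that Poly_Mapping.keys_add[of p q] by blast
  have mult: "?P (p * q)" if p: "?P p" and q: "?P q" for p q
  proof
    fix m assume "m \<in> Poly_Mapping.keys (p * q)"
    then obtain a b where "a \<in> Poly_Mapping.keys p" "b \<in> Poly_Mapping.keys q" "m = a + b"
      using Poly_Mapping.keys_mult[of p q] by blast
    then show "Poly_Mapping.keys m \<subseteq> V"
      using p q Poly_Mapping.keys_add[of a b] by blast
  qed
  have neg: "?P (- p)" if "?P p" for p
    using that by simp
  let ?R = "poly_ring V :: 'a mpoly ring"
  have simps: "\<And>p. p \<in> carrier ?R \<longleftrightarrow> ?P p" "\<And>p q. p \<otimes>\<^bsub>?R\<^esub> q = p * q"
    "\<And>p q. p \<oplus>\<^bsub>?R\<^esub> q = p + q" "\<one>\<^bsub>?R\<^esub> = 1" "\<zero>\<^bsub>?R\<^esub> = 0"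
    by (simp_all add: poly_ring_def)
  show ?thesis
  proof (intro cringI abelian_groupI comm_monoidI)
    fix x assume "x \<in> carrier ?R"
    then show "\<exists>y\<in>carrier ?R. y \<oplus>\<^bsub>?R\<^esub> x = \<zero>\<^bsub>?R\<^esub>"
      using neg by (intro bexI[of _ "- x"]) (simp_all add: simps)
  next
    fix x y assume "x \<in> carrier ?R" "y \<in> carrier ?R"
    then show "x \<oplus>\<^bsub>?R\<^esub> y \<in> carrier ?R" "x \<otimes>\<^bsub>?R\<^esub> y \<in> carrier ?R"
      unfolding simps by (rule add mult; assumption)+
  qed (simp_all add: simps ac_simps distrib_left distrib_right)
qed

definition induces_iso ::
  "('a, 'm) ring_scheme \<Rightarrow> 'a set \<Rightarrow> ('b, 'k) ring_scheme \<Rightarrow> 'b set \<Rightarrow> ('a \<Rightarrow> 'b) \<Rightarrow> bool" where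
  "induces_iso R I S J f \<longleftrightarrow> f ` I \<subseteq> J \<and>
     (\<exists>F \<in> ring_iso (R Quot I) (S Quot J). \<forall>p\<in>carrier R. F (I +>\<^bsub>R\<^esub> p) = J +>\<^bsub>S\<^esub> f p)"


section \<open>Terms, order ideals, borders and corners\<close>

text \<open>Terms are power products, written additively: \<open>s + t\<close> is the product of \<open>s\<close> and \<open>t\<close>.\<close>

definition terms :: "nat \<Rightarrow> pp set" where
  "terms n = {t. Poly_Mapping.keys t \<subseteq> X ` {..<n}}"

definition order_ideal :: "nat \<Rightarrow> pp set \<Rightarrow> bool" where
  "order_ideal n T \<longleftrightarrow> T \<subseteq> terms n \<and> finite T \<and> T \<noteq> {} \<and>
     (\<forall>s\<in>terms n. \<forall>u\<in>terms n. s + u \<in> T \<longrightarrow> s \<in> T)"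

definition border :: "nat \<Rightarrow> pp set \<Rightarrow> pp set" where
  "border n T = (\<Union>k<n. (\<lambda>t. xvar k + t) ` T) - T"

definition monoid_ideal :: "nat \<Rightarrow> pp set \<Rightarrow> pp set" where
  "monoid_ideal n G = {g + u | g u. g \<in> G \<and> u \<in> terms n}"

definition minimal_generators :: "nat \<Rightarrow> pp set \<Rightarrow> pp set \<Rightarrow> bool" where
  "minimal_generators n G M \<longleftrightarrow> monoid_ideal n G = M \<and> (\<forall>H. H \<subset> G \<longrightarrow> monoid_ideal n H \<noteq> M)"

definition term_ordering :: "nat \<Rightarrow> pp rel \<Rightarrow> bool" where
  "term_ordering n \<sigma> \<longleftrightarrow> linear_order_on (terms n) \<sigma> \<and>
     (\<forall>s\<in>terms n. \<forall>t\<in>terms n. \<forall>u\<in>terms n. (s, t) \<in> \<sigma> \<longrightarrow> (s + u, t + u) \<in> \<sigma>) \<and>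
     (\<forall>t\<in>terms n. (0, t) \<in> \<sigma>)"

definition less_term :: "pp rel \<Rightarrow> pp \<Rightarrow> pp \<Rightarrow> bool" where
  "less_term \<sigma> s t \<longleftrightarrow> (s, t) \<in> \<sigma> \<and> s \<noteq> t"

definition cornercut :: "pp rel \<Rightarrow> pp set \<Rightarrow> pp set \<Rightarrow> bool" where
  "cornercut \<sigma> T cT \<longleftrightarrow> (\<forall>b\<in>cT. \<forall>t\<in>T. less_term \<sigma> t b)"


section \<open>The border basis scheme and its universal family\<close>

definition x_indets :: "nat \<Rightarrow> indet set" where
  "x_indets n = X ` {..<n}"

definition c_indets :: "pp list \<Rightarrow> pp list \<Rightarrow> indet set" where
  "c_indets ts bs = {C i j | i j. i < length ts \<and> j < length bs}"

definition border_prebasis :: "pp list \<Rightarrow> pp list \<Rightarrow> nat \<Rightarrow> 'a::field mpoly" where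
  "border_prebasis ts bs j = mon (bs ! j) - (\<Sum>i<length ts. cvar i j * mon (ts ! i))"

definition index_of :: "pp list \<Rightarrow> pp \<Rightarrow> nat" where
  "index_of us u = (THE m. m < length us \<and> us ! m = u)"

definition mult_matrix :: "pp list \<Rightarrow> pp list \<Rightarrow> nat \<Rightarrow> 'a::field mpoly mat" where
  "mult_matrix ts bs k = mat (length ts) (length ts) (\<lambda>(i, j).
     let u = xvar k + ts ! j in
     if u \<in> set ts then (if i = index_of ts u then 1 else 0) else cvar i (index_of bs u))"

definition ideal_B :: "nat \<Rightarrow> pp list \<Rightarrow> pp list \<Rightarrow> 'a::field mpoly set" where
  "ideal_B n ts bs = Idl\<^bsub>poly_ring (c_indets ts bs)\<^esub>
     {(mult_matrix ts bs k * mult_matrix ts bs l - mult_matrix ts bs l * mult_matrix ts bs k) $$ (i, j)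
      | k l i j. k < l \<and> l < n \<and> i < length ts \<and> j < length ts}"

definition ideal_U :: "nat \<Rightarrow> pp list \<Rightarrow> pp list \<Rightarrow> 'a::field mpoly set" where
  "ideal_U n ts bs = (let R = poly_ring (x_indets n \<union> c_indets ts bs) in
     Idl\<^bsub>R\<^esub> (ideal_B n ts bs) <+>\<^bsub>R\<^esub> Idl\<^bsub>R\<^esub> (border_prebasis ts bs ` {..<length bs}))"


section \<open>The Groebner basis scheme and its universal family\<close>

definition S_indets :: "pp rel \<Rightarrow> pp list \<Rightarrow> pp list \<Rightarrow> indet set" where
  "S_indets \<sigma> ts bs =
     {C i j | i j. i < length ts \<and> j < length bs \<and> less_term \<sigma> (ts ! i) (bs ! j)}"

text \<open>Here and below \<open>\<eta>\<close> is the number of corners, which are the first \<open>\<eta>\<close> entries of \<open>bs\<close>.\<close>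

definition Sc_indets :: "pp rel \<Rightarrow> pp list \<Rightarrow> pp list \<Rightarrow> nat \<Rightarrow> indet set" where
  "Sc_indets \<sigma> ts bs \<eta> = {C i j | i j. C i j \<in> S_indets \<sigma> ts bs \<and> j < \<eta>}"

definition ideal_L :: "pp rel \<Rightarrow> pp list \<Rightarrow> pp list \<Rightarrow> 'a::field mpoly set" where
  "ideal_L \<sigma> ts bs = Idl\<^bsub>poly_ring (c_indets ts bs)\<^esub>
     {cvar i j | i j. C i j \<in> c_indets ts bs - S_indets \<sigma> ts bs}"

definition star_prebasis :: "pp rel \<Rightarrow> pp list \<Rightarrow> pp list \<Rightarrow> nat \<Rightarrow> 'a::field mpoly" where
  "star_prebasis \<sigma> ts bs j = mon (bs ! j) -
     (\<Sum>i | i < length ts \<and> less_term \<sigma> (ts ! i) (bs ! j). cvar i j * mon (ts ! i))"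

definition ideal_G :: "nat \<Rightarrow> pp rel \<Rightarrow> pp list \<Rightarrow> pp list \<Rightarrow> nat \<Rightarrow> 'a::field mpoly set" where
  "ideal_G n \<sigma> ts bs \<eta> =
     (ideal_L \<sigma> ts bs <+>\<^bsub>poly_ring (c_indets ts bs)\<^esub> ideal_B n ts bs)
       \<inter> carrier (poly_ring (Sc_indets \<sigma> ts bs \<eta>))"

definition ideal_GU :: "nat \<Rightarrow> pp rel \<Rightarrow> pp list \<Rightarrow> pp list \<Rightarrow> nat \<Rightarrow> 'a::field mpoly set" where
  "ideal_GU n \<sigma> ts bs \<eta> = (let R = poly_ring (x_indets n \<union> Sc_indets \<sigma> ts bs \<eta>) in
     Idl\<^bsub>R\<^esub> (ideal_G n \<sigma> ts bs \<eta>) <+>\<^bsub>R\<^esub> Idl\<^bsub>R\<^esub> (star_prebasis \<sigma> ts bs ` {..<\<eta>}))"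

end

theory Submission
  imports Defs
begin

text \<open>
  Write $A = K[\mathbf{c}]$ and $A' = K[S_{c\mathcal{O},\sigma}]$. An inclusion of polynomial rings
  induces an isomorphism of quotients exactly if the smaller ideal is the contraction of the larger
  one and the smaller ring maps onto the larger quotient (\<open>induces_iso_inclusion_iff\<close>), so all
  three implications are statements about membership in ideals. Two facts supply it.

  Division (\<open>division\<close>): modulo the polynomials $g_1^*,\dots,g_\eta^*$ every element of
  $A'[\mathbf{x}]$ is a combination $\sum_i a_i t_i$ with $a_i \in A'$. Indeed a term outside
  $\mathcal{O}$ is a multiple $u b_j$ of a corner, and subtracting $u g_j^*$ replaces it by
  $\sigma$-smaller terms; by Dickson's lemma $\sigma$ is a well-ordering, so this process ends.

  Independence (the locale \<open>commuting_quotient\<close>): let $J$ be an ideal of $A$ that contains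
  $I(\mathbb{B}_{\mathcal{O}})$. The generic multiplication matrices commute modulo $J$, so
  $p \mapsto p(\mathcal{A}_1,\dots,\mathcal{A}_n)\, e$, with $e$ the basis vector of the term $1$,
  makes sense modulo $J$. Its kernel is an ideal that contains $J$ and all $g_j$, and $t_i$ is sent
  to the $i$-th basis vector. Hence $\sum_i a_i t_i$ lies in that ideal only if all $a_i \in J$.

  With $J = I(\mathbb{B}_{\mathcal{O}})$, a relation $\sum_i a_i t_i = 0$ in $U_{\mathcal{O}}$ forces
  $a_i \in I(\mathbb{B}_{\mathcal{O}})$; with $J = L_{\mathcal{O},\sigma} + I(\mathbb{B}_{\mathcal{O}})$,
  modulo which $g_j^*$ and $g_j$ agree, $G_{\mathcal{O},\sigma}$ embeds into $U_{\mathcal{O},\sigma}$.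
  The equivalence of $a_1$ and $a_2$ follows by dividing an element of $A'[\mathbf{x}]$ and comparing
  coefficients. If $L_{\mathcal{O},\sigma} = 0$, then $g_j^* = g_j$ for the corners, and dividing a
  border term $b_j$ gives $b_j \equiv \sum_i a_i t_i$ with $a_i \in A'$, while
  $b_j \equiv \sum_i c_{ij} t_i$; so each $c_{ij}$ is congruent to an element of $A'$, which is $a_1$.
  Finally, both $b_1$ and $b_2$ say that every border term exceeds every term of $\mathcal{O}$, since
  each border term is a multiple of a corner.
\<close>

section \<open>Polynomial rings and their ideals\<close>

abbreviation polys :: "indet set \<Rightarrow> 'a::field mpoly set" where
  "polys V \<equiv> carrier (poly_ring V)"

lemma poly_ring_ops [simp]:
  "p \<otimes>\<^bsub>poly_ring V\<^esub> q = p * q" "p \<oplus>\<^bsub>poly_ring V\<^esub> q = p + q"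
  "\<one>\<^bsub>poly_ring V\<^esub> = 1" "\<zero>\<^bsub>poly_ring V\<^esub> = 0"
  by (simp_all add: poly_ring_def)

lemma mem_polys: "p \<in> polys V \<longleftrightarrow> (\<forall>m\<in>Poly_Mapping.keys p. Poly_Mapping.keys m \<subseteq> V)"
  by (simp add: poly_ring_def)

lemma ring_poly_ring: "ring (poly_ring V)"
  using cring_poly_ring cring.axioms(1) by blast

lemma polys_zero [simp]: "0 \<in> polys V"
  and polys_one [simp]: "1 \<in> polys V"
  and polys_uminus [simp]: "p \<in> polys V \<Longrightarrow> - p \<in> polys V"
  by (simp_all add: mem_polys)

lemma polys_add [simp]: "p \<in> polys V \<Longrightarrow> q \<in> polys V \<Longrightarrow> p + q \<in> polys V"
  and polys_mult [simp]: "p \<in> polys V \<Longrightarrow> q \<in> polys V \<Longrightarrow> p * q \<in> polys V"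
  using ring.ring_simprules(1,5)[OF ring_poly_ring[of V]] by auto

lemma polys_diff [simp]: "p \<in> polys V \<Longrightarrow> q \<in> polys V \<Longrightarrow> p - q \<in> polys V"
  using polys_add[of p V "- q"] by simp

lemma polys_sum [simp]: "(\<And>i. i \<in> I \<Longrightarrow> f i \<in> polys V) \<Longrightarrow> sum f I \<in> polys V"
  by (induction I rule: infinite_finite_induct) auto

lemma polys_mono: "V \<subseteq> W \<Longrightarrow> polys V \<subseteq> polys W"
  by (intro subsetI) (simp add: mem_polys, blast)

lemma single_in_polys [simp]: "Poly_Mapping.keys m \<subseteq> V \<Longrightarrow> Poly_Mapping.single m c \<in> polys V"
  by (simp add: mem_polys)

lemma mon_in_polys [simp]: "Poly_Mapping.keys m \<subseteq> V \<Longrightarrow> mon m \<in> polys V"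
  by (simp add: mon_def)

lemma cvar_in_polys [simp]: "C i j \<in> V \<Longrightarrow> cvar i j \<in> polys V"
  by (simp add: cvar_def)

lemma poly_ring_minus:
  assumes "p \<in> polys V" "q \<in> polys V"
  shows "p \<ominus>\<^bsub>poly_ring V\<^esub> q = p - q"
proof -
  interpret ring "poly_ring V" by (rule ring_poly_ring)
  have "\<ominus>\<^bsub>poly_ring V\<^esub> q = - q"
    using assms by (intro minus_equality) auto
  then show ?thesis by (simp add: a_minus_def)
qed

lemma ideal_poly_ringI:
  fixes I :: "'a::field mpoly set"
  assumes sub: "I \<subseteq> polys V" and zero: "0 \<in> I"
    and add: "\<And>p q. p \<in> I \<Longrightarrow> q \<in> I \<Longrightarrow> p + q \<in> I"
    and mult: "\<And>a p. a \<in> polys V \<Longrightarrow> p \<in> I \<Longrightarrow> a * p \<in> I"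
  shows "ideal I (poly_ring V)"
proof -
  interpret ring "poly_ring V :: 'a mpoly ring" by (rule ring_poly_ring)
  show ?thesis
  proof (rule idealI)
    show "subgroup I (add_monoid (poly_ring V))"
    proof (rule add.subgroupI)
      fix p assume p: "p \<in> I"
      then have "\<ominus>\<^bsub>poly_ring V\<^esub> p = - p"
        using sub by (intro minus_equality) auto
      then show "\<ominus>\<^bsub>poly_ring V\<^esub> p \<in> I"
        using mult[of "-1" p] p by simp
    qed (use sub zero add in auto)
  next
    fix a p :: "'a mpoly" assume "p \<in> I" "a \<in> polys V"
    then show "p \<otimes>\<^bsub>poly_ring V\<^esub> a \<in> I" "a \<otimes>\<^bsub>poly_ring V\<^esub> p \<in> I"
      using mult[of a p] by (auto simp: mult.commute)
  qed (rule ring_poly_ring)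
qed

lemma
  assumes "ideal I (poly_ring V)"
  shows ideal_sub: "I \<subseteq> polys V"
    and ideal_zero: "0 \<in> I"
    and ideal_add: "p \<in> I \<Longrightarrow> q \<in> I \<Longrightarrow> p + q \<in> I"
    and ideal_mult: "a \<in> polys V \<Longrightarrow> p \<in> I \<Longrightarrow> a * p \<in> I"
    and ideal_uminus: "p \<in> I \<Longrightarrow> - p \<in> I"
    and ideal_diff: "p \<in> I \<Longrightarrow> q \<in> I \<Longrightarrow> p - q \<in> I"
    and ideal_sum: "(\<And>k. k \<in> S \<Longrightarrow> f k \<in> I) \<Longrightarrow> sum f S \<in> I"
proof -
  interpret ideal I "poly_ring V" by fact
  show "I \<subseteq> polys V" by (rule a_subset)
  show "0 \<in> I"
    using additive_subgroup.zero_closed[OF ideal.axioms(1)[OF assms]] by simp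
  show add: "p \<in> I \<Longrightarrow> q \<in> I \<Longrightarrow> p + q \<in> I" for p q
    using additive_subgroup.a_closed[OF ideal.axioms(1)[OF assms], of p q] by simp
  show mult: "a \<in> polys V \<Longrightarrow> p \<in> I \<Longrightarrow> a * p \<in> I" for a p
    using I_l_closed[of p a] by auto
  show um: "p \<in> I \<Longrightarrow> - p \<in> I" for p
    using mult[of "-1" p] by simp
  show "p \<in> I \<Longrightarrow> q \<in> I \<Longrightarrow> p - q \<in> I" for p q
    using add[of p "- q"] um[of q] by simp
  show "(\<And>k. k \<in> S \<Longrightarrow> f k \<in> I) \<Longrightarrow> sum f S \<in> I"
    by (induction S rule: infinite_finite_induct) (use \<open>0 \<in> I\<close> add in auto)
qed

lemma ideal_cong:
  assumes "ideal I (poly_ring V)" "p - q \<in> I"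
  shows "p \<in> I \<longleftrightarrow> q \<in> I"
  using ideal_add[OF assms, of q] ideal_diff[OF assms(1) _ assms(2), of p] by auto

lemma ideal_Int_polys:
  assumes I: "ideal I (poly_ring W)" and "V \<subseteq> W"
  shows "ideal (I \<inter> polys V) (poly_ring V)"
  using polys_mono[OF \<open>V \<subseteq> W\<close>] ideal_zero[OF I] ideal_add[OF I] ideal_mult[OF I]
  by (intro ideal_poly_ringI) auto

text \<open>
  The ideals of the two universal families have this form. Through these four properties they can
  be used as the smallest ideal containing both sets of generators.
\<close>

lemma sum_of_generated_ideals:
  fixes A B :: "'a::field mpoly set"
  assumes "A \<subseteq> polys V" "B \<subseteq> polys V"
  defines "J \<equiv> Idl\<^bsub>poly_ring V\<^esub> A <+>\<^bsub>poly_ring V\<^esub> Idl\<^bsub>poly_ring V\<^esub> B"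
  shows "ideal J (poly_ring V)" "A \<subseteq> J" "B \<subseteq> J"
    and "\<And>I. ideal I (poly_ring V) \<Longrightarrow> A \<subseteq> I \<Longrightarrow> B \<subseteq> I \<Longrightarrow> J \<subseteq> I"
proof -
  interpret ring "poly_ring V :: 'a mpoly ring" by (rule ring_poly_ring)
  have IA: "ideal (Idl\<^bsub>poly_ring V\<^esub> A) (poly_ring V)" and IB: "ideal (Idl\<^bsub>poly_ring V\<^esub> B) (poly_ring V)"
    using assms(1,2) by (auto intro: genideal_ideal)
  show "ideal J (poly_ring V)"
    unfolding J_def by (intro add_ideals IA IB)
  have J: "J = {p + q | p q. p \<in> Idl\<^bsub>poly_ring V\<^esub> A \<and> q \<in> Idl\<^bsub>poly_ring V\<^esub> B}"
    by (auto simp: J_def set_add_def set_mult_def)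
  have "p \<in> J" if "p \<in> Idl\<^bsub>poly_ring V\<^esub> A" for p
    unfolding J using that ideal_zero[OF IB] by force
  moreover have "p \<in> J" if "p \<in> Idl\<^bsub>poly_ring V\<^esub> B" for p
    unfolding J using that ideal_zero[OF IA] by force
  ultimately show "A \<subseteq> J" "B \<subseteq> J"
    using genideal_self[OF assms(1)] genideal_self[OF assms(2)] by auto
  fix I assume I: "ideal I (poly_ring V)" "A \<subseteq> I" "B \<subseteq> I"
  show "J \<subseteq> I"
    using genideal_minimal[OF I(1,2)] genideal_minimal[OF I(1,3)] ideal_add[OF I(1)]
    unfolding J by blast
qed

lemma pp_induct [consumes 1, case_names zero add]:
  fixes m :: pp
  assumes "Poly_Mapping.keys m \<subseteq> V" and zero: "P 0"
    and add: "\<And>v m. v \<in> V \<Longrightarrow> Poly_Mapping.keys m \<subseteq> V \<Longrightarrow> P m \<Longrightarrow> P (Poly_Mapping.single v 1 + m)"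
  shows "P m"
  using assms(1)
proof (induction "\<Sum>v\<in>Poly_Mapping.keys m. Poly_Mapping.lookup m v" arbitrary: m rule: less_induct)
  case (less m)
  show ?case
  proof (cases "m = 0")
    case False
    then obtain v where v: "v \<in> Poly_Mapping.keys m"
      using keys_eq_empty by blast
    define m' where "m' = m - Poly_Mapping.single v 1"
    have lk: "Poly_Mapping.lookup m' u = Poly_Mapping.lookup m u - (if u = v then 1 else 0)" for u
      by (simp add: m'_def lookup_minus lookup_single when_def)
    have pos: "Poly_Mapping.lookup m v > 0"
      using v by (simp add: in_keys_iff)
    have m: "m = Poly_Mapping.single v 1 + m'"
      using pos by (intro poly_mapping_eqI) (simp add: lookup_add lookup_single when_def lk)
    have sub: "Poly_Mapping.keys m' \<subseteq> Poly_Mapping.keys m"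
      by (auto simp: in_keys_iff lk)
    have "(\<Sum>v\<in>Poly_Mapping.keys m'. Poly_Mapping.lookup m' v)
        = (\<Sum>v\<in>Poly_Mapping.keys m. Poly_Mapping.lookup m' v)"
      by (rule sum.mono_neutral_left) (use sub in \<open>auto simp: in_keys_iff\<close>)
    also have "\<dots> < (\<Sum>v\<in>Poly_Mapping.keys m. Poly_Mapping.lookup m v)"
      by (rule sum_strict_mono_ex1) (use v pos in \<open>auto simp: lk\<close>)
    finally have "P m'"
      using less sub by blast
    then show ?thesis
      using add[of v m'] v sub less.prems m by auto
  qed (simp add: zero)
qed

lemma poly_induct [consumes 1, case_names single add]:
  fixes p :: "'a::field mpoly"
  assumes "p \<in> polys V"
    and single: "\<And>m c. Poly_Mapping.keys m \<subseteq> V \<Longrightarrow> P (Poly_Mapping.single m c)"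
    and add: "\<And>p q. p \<in> polys V \<Longrightarrow> q \<in> polys V \<Longrightarrow> P p \<Longrightarrow> P q \<Longrightarrow> P (p + q)"
  shows "P p"
proof -
  have p: "(\<Sum>m\<in>Poly_Mapping.keys p. Poly_Mapping.single m (Poly_Mapping.lookup p m)) = p"
    by (intro poly_mapping_eqI)
      (auto simp: lookup_sum lookup_single when_def in_keys_iff)
  have "P (\<Sum>m\<in>M. Poly_Mapping.single m (Poly_Mapping.lookup p m))"
    if "M \<subseteq> Poly_Mapping.keys p" for M
    using finite_subset[OF that finite_keys] that
  proof (induction M rule: finite_induct)
    case empty
    then show ?case using single[of 0 0] by simp
  next
    case (insert m M)
    then show ?case
      using assms(1) by (auto simp: mem_polys intro!: add single polys_sum)
  qed
  from this[OF order.refl] show ?thesis by (simp add: p)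
qed

lemma polys_subring_induct:
  fixes S :: "'a::field mpoly set"
  assumes "p \<in> polys V"
    and const: "\<And>c. Poly_Mapping.single 0 c \<in> S"
    and var: "\<And>v. v \<in> V \<Longrightarrow> mon (Poly_Mapping.single v 1) \<in> S"
    and add: "\<And>p q. p \<in> S \<Longrightarrow> q \<in> S \<Longrightarrow> p + q \<in> S"
    and mult: "\<And>p q. p \<in> S \<Longrightarrow> q \<in> S \<Longrightarrow> p * q \<in> S"
  shows "p \<in> S"
  using assms(1)
proof (induction p rule: poly_induct)
  case (single m c)
  then show ?case
  proof (induction m rule: pp_induct)
    case (add v m)
    then have "mon (Poly_Mapping.single v 1) * Poly_Mapping.single m c \<in> S"
      by (intro mult var)
    then show ?case by (simp add: mon_def mult_single)
  qed (rule const)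
qed (rule add)

lemma cvar_nonzero: "cvar i j \<noteq> (0 :: 'a::field mpoly)"
proof -
  have "Poly_Mapping.keys (cvar i j :: 'a mpoly) \<noteq> {}"
    by (simp add: cvar_def mon_def)
  then show ?thesis by auto
qed

text \<open>
  The elements of the large ring that are congruent to an element of the small one form a subring
  containing the constants, so it is enough to test the indeterminates.
\<close>

lemma surjective_from_indets:
  fixes I :: "'a::field mpoly set"
  assumes I: "ideal I (poly_ring W)" and "V \<subseteq> W"
    and ex: "\<And>v. v \<in> W \<Longrightarrow> \<exists>r\<in>polys V. mon (Poly_Mapping.single v 1) - r \<in> I"
    and s: "s \<in> polys W"
  shows "\<exists>r\<in>polys V. s - r \<in> I"
proof -
  have VW: "polys V \<subseteq> (polys W :: 'a mpoly set)" by (rule polys_mono[OF \<open>V \<subseteq> W\<close>])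
  define S where "S = {s \<in> polys W. \<exists>r\<in>polys V. s - r \<in> I}"
  have "s \<in> S"
    using s
  proof (rule polys_subring_induct)
    show "Poly_Mapping.single 0 c \<in> S" for c
      using ideal_zero[OF I] by (auto simp: S_def intro!: bexI[of _ "Poly_Mapping.single 0 c"])
    show "mon (Poly_Mapping.single v 1) \<in> S" if "v \<in> W" for v
      using ex[OF that] that by (auto simp: S_def)
  next
    fix p q assume "p \<in> S" "q \<in> S"
    then obtain r r' where pq: "p \<in> polys W" "q \<in> polys W"
      and r: "r \<in> polys V" "p - r \<in> I" and r': "r' \<in> polys V" "q - r' \<in> I"
      by (auto simp: S_def)
    have "(p + q) - (r + r') \<in> I"
      using ideal_add[OF I r(2) r'(2)] by (simp add: add_diff_add)
    then show "p + q \<in> S"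
      using pq r(1) r'(1) by (auto simp: S_def intro!: bexI[of _ "r + r'"])
    have "p * q - r * r' = p * (q - r') + r' * (p - r)"
      by (simp add: algebra_simps)
    moreover have "p * (q - r') \<in> I" "r' * (p - r) \<in> I"
      using pq r r' VW by (auto intro!: ideal_mult[OF I])
    ultimately have "p * q - r * r' \<in> I"
      using ideal_add[OF I] by simp
    then show "p * q \<in> S"
      using pq r(1) r'(1) by (auto simp: S_def intro!: bexI[of _ "r * r'"])
  qed
  then show ?thesis by (simp add: S_def)
qed

text \<open>
  For an inclusion, well-definedness and injectivity together say that \<open>I\<close> is the contraction of
  \<open>J\<close>; the last conjunct is surjectivity.
\<close>

lemma induces_iso_inclusion_iff:
  fixes I J :: "'a::field mpoly set"
  assumes "V \<subseteq> W" and I: "ideal I (poly_ring V)" and J: "ideal J (poly_ring W)"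
  shows "induces_iso (poly_ring V) I (poly_ring W) J (\<lambda>p. p) \<longleftrightarrow>
    I \<subseteq> J \<and> J \<inter> polys V \<subseteq> I \<and> (\<forall>s\<in>polys W. \<exists>r\<in>polys V. s - r \<in> J)"
    (is "?L \<longleftrightarrow> ?R")
proof -
  let ?V = "poly_ring V :: 'a mpoly ring" and ?W = "poly_ring W :: 'a mpoly ring"
  interpret V: ring ?V by (rule ring_poly_ring)
  interpret W: ring ?W by (rule ring_poly_ring)
  interpret I: ideal I ?V by fact
  interpret J: ideal J ?W by fact
  have VW: "polys V \<subseteq> (polys W :: 'a mpoly set)"
    using assms(1) by (rule polys_mono)
  have eqI: "I +>\<^bsub>?V\<^esub> p = I +>\<^bsub>?V\<^esub> q \<longleftrightarrow> p - q \<in> I" if "p \<in> polys V" "q \<in> polys V" for p q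
    using V.quotient_eq_iff_same_a_r_cos[OF I that] that by (simp add: poly_ring_minus)
  have eqJ: "J +>\<^bsub>?W\<^esub> p = J +>\<^bsub>?W\<^esub> q \<longleftrightarrow> p - q \<in> J" if "p \<in> polys W" "q \<in> polys W" for p q
    using W.quotient_eq_iff_same_a_r_cos[OF J that] that by (simp add: poly_ring_minus)
  have carr: "carrier (?V Quot I) = (\<lambda>p. I +>\<^bsub>?V\<^esub> p) ` polys V"
    "carrier (?W Quot J) = (\<lambda>p. J +>\<^bsub>?W\<^esub> p) ` polys W"
    by (auto simp: FactRing_def A_RCOSETS_def')
  show ?thesis
  proof
    assume ?L
    then obtain F where F: "F \<in> ring_iso (?V Quot I) (?W Quot J)"
      and FI: "\<And>p. p \<in> polys V \<Longrightarrow> F (I +>\<^bsub>?V\<^esub> p) = J +>\<^bsub>?W\<^esub> p" and IJ: "I \<subseteq> J"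
      by (auto simp: induces_iso_def)
    have bij: "bij_betw F (carrier (?V Quot I)) (carrier (?W Quot J))"
      using F by (simp add: ring_iso_def)
    have "p \<in> I" if "p \<in> J" "p \<in> polys V" for p
    proof -
      have "F (I +>\<^bsub>?V\<^esub> p) = F (I +>\<^bsub>?V\<^esub> 0)"
        using that VW eqJ[of p 0] by (auto simp: FI)
      then have "I +>\<^bsub>?V\<^esub> p = I +>\<^bsub>?V\<^esub> 0"
        using bij that(2) by (auto simp: bij_betw_def carr dest: inj_onD)
      then show ?thesis using eqI[of p 0] that by simp
    qed
    moreover have "\<exists>r\<in>polys V. s - r \<in> J" if "s \<in> polys W" for s
    proof -
      have "J +>\<^bsub>?W\<^esub> s \<in> F ` carrier (?V Quot I)"
        using bij that by (auto simp: bij_betw_def carr)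
      then obtain r where "r \<in> polys V" "J +>\<^bsub>?W\<^esub> s = J +>\<^bsub>?W\<^esub> r"
        by (auto simp: carr FI)
      then show ?thesis using eqJ[of s r] that VW by auto
    qed
    ultimately show ?R using IJ by blast
  next
    assume R: ?R
    then have IJ: "I \<subseteq> J" and JI: "J \<inter> polys V \<subseteq> I"
      and ex: "\<And>s. s \<in> polys W \<Longrightarrow> \<exists>r\<in>polys V. s - r \<in> J"
      by auto
    let ?h = "\<lambda>p. J +>\<^bsub>?W\<^esub> p"
    have "ring_hom_ring ?V (?W Quot J) ?h"
    proof (rule ring_hom_ringI2)
      show "ring (?W Quot J)" by (rule J.quotient_is_ring)
      show "?h \<in> ring_hom ?V (?W Quot J)"
      proof (rule ring_hom_memI)
        fix p q :: "'a mpoly" assume "p \<in> polys V" "q \<in> polys V"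
        then have pq: "p \<in> polys W" "q \<in> polys W" using VW by auto
        show "?h p \<in> carrier (?W Quot J)" using pq by (auto simp: carr)
        show "?h (p \<otimes>\<^bsub>?V\<^esub> q) = ?h p \<otimes>\<^bsub>?W Quot J\<^esub> ?h q"
          using ring_hom_mult[OF J.rcos_ring_hom pq] by simp
        show "?h (p \<oplus>\<^bsub>?V\<^esub> q) = ?h p \<oplus>\<^bsub>?W Quot J\<^esub> ?h q"
          using ring_hom_add[OF J.rcos_ring_hom pq] by simp
      qed (use ring_hom_one[OF J.rcos_ring_hom] in simp)
    qed (rule ring_poly_ring)
    then interpret h: ring_hom_ring ?V "?W Quot J" ?h .
    have J0: "?h 0 = J"
      by (simp add: set_eq_iff a_r_coset_def')
    have "a_kernel ?V (?W Quot J) ?h = {p \<in> polys V. ?h p = ?h 0}"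
      by (simp only: a_kernel_def' FactRing_def ring.simps J0)
    also have "\<dots> = {p \<in> polys V. p \<in> J}"
    proof (intro Collect_cong conj_cong refl)
      fix p :: "'a mpoly" assume "p \<in> polys V"
      then have "p \<in> polys W" using VW by blast
      then show "?h p = ?h 0 \<longleftrightarrow> p \<in> J" using eqJ[of p 0] by simp
    qed
    also have "\<dots> = I" using IJ JI ideal_sub[OF I] by (intro equalityI subsetI) auto
    finally have ker: "a_kernel ?V (?W Quot J) ?h = I" .
    have surj: "?h ` polys V = carrier (?W Quot J)"
    proof -
      have "?h s \<in> ?h ` polys V" if "s \<in> polys W" for s
      proof -
        obtain r where "r \<in> polys V" "s - r \<in> J" using ex[OF \<open>s \<in> polys W\<close>] by blast
        then have "?h s = ?h r" using eqJ[of s r] that subsetD[OF VW] by simp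
        then show ?thesis using \<open>r \<in> polys V\<close> by (rule image_eqI)
      qed
      then show ?thesis unfolding carr by (intro equalityI image_mono VW image_subsetI)
    qed
    have "\<forall>p\<in>polys V. the_elem (?h ` (I +>\<^bsub>?V\<^esub> p)) = ?h p"
      using h.the_elem_simp by (simp add: ker)
    moreover have "(\<lambda>c. the_elem (?h ` c)) \<in> ring_iso (?V Quot I) (?W Quot J)"
      using h.FactRing_iso_set[OF surj] by (simp only: ker)
    moreover have "(\<lambda>p. p) ` I \<subseteq> J" using IJ by simp
    ultimately show ?L
      unfolding induces_iso_def by (intro conjI bexI) assumption+
  qed
qed


section \<open>Division by a prebasis with leading terms at the corners\<close>

text \<open>
  A monotone subsequence of natural numbers is either nondecreasing or, being nonincreasing and
  bounded below, constant from the point on where it attains its least value.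
\<close>

lemma mono_subsequence:
  fixes f :: "nat \<Rightarrow> nat"
  shows "\<exists>r :: nat \<Rightarrow> nat. strict_mono r \<and> mono (\<lambda>i. f (r i))"
proof -
  obtain g :: "nat \<Rightarrow> nat" where g: "strict_mono g" and "monoseq (\<lambda>i. f (g i))"
    using seq_monosub by blast
  then consider "mono (\<lambda>i. f (g i))" | "decseq (\<lambda>i. f (g i))"
    by (auto simp: monoseq_iff)
  then show ?thesis
  proof cases
    case 2
    obtain N where N: "\<And>i. f (g N) \<le> f (g i)"
      using ex_has_least_nat[of "\<lambda>_. True" 0 "\<lambda>i. f (g i)"] by auto
    have "f (g (N + i)) = f (g N)" for i
      using N[of "N + i"] decseqD[OF 2, of N "N + i"] by simp
    then have "mono (\<lambda>i. f (g (N + i)))" by (simp add: mono_def)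
    moreover have "strict_mono (\<lambda>i. g (N + i))"
      using g by (simp add: strict_mono_def)
    ultimately show ?thesis by (intro exI[of _ "\<lambda>i. g (N + i)"]) simp
  qed (use g in blast)
qed

text \<open>
  A form of Dickson's lemma: passing to subsequences one indeterminate after the other makes all
  exponents nondecreasing.
\<close>

lemma mono_subsequence_lookup:
  fixes f :: "nat \<Rightarrow> pp"
  assumes "finite V"
  shows "\<exists>r :: nat \<Rightarrow> nat. strict_mono r \<and> (\<forall>v\<in>V. mono (\<lambda>i. Poly_Mapping.lookup (f (r i)) v))"
  using assms
proof (induction V rule: finite_induct)
  case empty
  show ?case by (auto intro!: exI[of _ id] simp: strict_mono_def)
next
  case (insert w V)
  then obtain r :: "nat \<Rightarrow> nat" where r: "strict_mono r" "\<forall>v\<in>V. mono (\<lambda>i. Poly_Mapping.lookup (f (r i)) v)"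
    by blast
  obtain q :: "nat \<Rightarrow> nat" where q: "strict_mono q" "mono (\<lambda>i. Poly_Mapping.lookup (f (r (q i))) w)"
    using mono_subsequence[of "\<lambda>i. Poly_Mapping.lookup (f (r i)) w"] by auto
  have "strict_mono (\<lambda>i. r (q i))"
    using r(1) q(1) by (simp add: strict_mono_def)
  moreover have "mono (\<lambda>i. Poly_Mapping.lookup (f (r (q i))) v)" if "v \<in> V" for v
    using r(2) strict_mono_mono[OF q(1)] that by (auto simp: mono_def)
  ultimately show ?case
    using q(2) by (intro exI[of _ "\<lambda>i. r (q i)"]) auto
qed

lemma terms_add: "s \<in> terms n \<Longrightarrow> t \<in> terms n \<Longrightarrow> s + t \<in> terms n"
  using Poly_Mapping.keys_add[of s t] by (auto simp: terms_def)

lemma xvar_in_terms: "k < n \<Longrightarrow> xvar k \<in> terms n"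
  by (auto simp: terms_def xvar_def)

lemma
  assumes "term_ordering n \<sigma>"
  shows term_ordering_trans: "(s, t) \<in> \<sigma> \<Longrightarrow> (t, u) \<in> \<sigma> \<Longrightarrow> (s, u) \<in> \<sigma>"
    and term_ordering_antisym: "(s, t) \<in> \<sigma> \<Longrightarrow> (t, s) \<in> \<sigma> \<Longrightarrow> s = t"
    and term_ordering_add: "s \<in> terms n \<Longrightarrow> t \<in> terms n \<Longrightarrow> u \<in> terms n \<Longrightarrow>
      (s, t) \<in> \<sigma> \<Longrightarrow> (s + u, t + u) \<in> \<sigma>"
    and term_ordering_zero: "t \<in> terms n \<Longrightarrow> (0, t) \<in> \<sigma>"
proof -
  have "trans \<sigma>" "antisym \<sigma>"
    using assms
    by (simp_all add: term_ordering_def linear_order_on_def partial_order_on_def preorder_on_def)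
  then show "(s, t) \<in> \<sigma> \<Longrightarrow> (t, u) \<in> \<sigma> \<Longrightarrow> (s, u) \<in> \<sigma>"
    and "(s, t) \<in> \<sigma> \<Longrightarrow> (t, s) \<in> \<sigma> \<Longrightarrow> s = t"
    unfolding trans_def antisym_def by blast+
  show "s \<in> terms n \<Longrightarrow> t \<in> terms n \<Longrightarrow> u \<in> terms n \<Longrightarrow> (s, t) \<in> \<sigma> \<Longrightarrow> (s + u, t + u) \<in> \<sigma>"
    and "t \<in> terms n \<Longrightarrow> (0, t) \<in> \<sigma>"
    using assms by (simp_all add: term_ordering_def)
qed

lemma less_term_le_trans:
  assumes "term_ordering n \<sigma>" "less_term \<sigma> s t" "(t, u) \<in> \<sigma>"
  shows "less_term \<sigma> s u"
  using term_ordering_trans[OF assms(1)] term_ordering_antisym[OF assms(1)] assms(2,3)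
  unfolding less_term_def by blast

lemma less_term_add:
  assumes "term_ordering n \<sigma>" "less_term \<sigma> s t" "s \<in> terms n" "t \<in> terms n" "u \<in> terms n"
  shows "less_term \<sigma> (s + u) (t + u)"
  using term_ordering_add[OF assms(1,3,4,5)] assms(2) by (auto simp: less_term_def)

lemma term_ordering_le_add:
  assumes "term_ordering n \<sigma>" "s \<in> terms n" "u \<in> terms n"
  shows "(s, s + u) \<in> \<sigma>"
  using term_ordering_add[OF assms(1) _ assms(3,2), of 0] term_ordering_zero[OF assms(1,3)]
  by (simp add: terms_def add.commute)

text \<open>
  In an infinite strictly descending sequence of terms some term would divide a later one by
  Dickson's lemma, whereas a divisor is never larger.
\<close>

lemma wf_term_ordering:
  assumes \<sigma>: "term_ordering n \<sigma>"
  shows "wf {(s, t). s \<in> terms n \<and> t \<in> terms n \<and> less_term \<sigma> s t}"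
proof (rule ccontr)
  assume "\<not> ?thesis"
  then obtain f where f: "\<And>i. f i \<in> terms n" "\<And>i. less_term \<sigma> (f (Suc i)) (f i)"
    unfolding wf_iff_no_infinite_down_chain by auto
  have desc: "less_term \<sigma> (f j) (f i)" if "i < j" for i j
    using that
  proof (induction j)
    case (Suc j)
    then show ?case
      using f(2)[of j] less_term_le_trans[OF \<sigma> f(2)[of j]]
      by (cases "i = j") (auto simp: less_term_def)
  qed simp
  obtain r :: "nat \<Rightarrow> nat" where r: "strict_mono r"
    "\<And>v. v \<in> X ` {..<n} \<Longrightarrow> mono (\<lambda>i. Poly_Mapping.lookup (f (r i)) v)"
    using mono_subsequence_lookup[of "X ` {..<n}" f] by auto
  define u where "u = f (r 1) - f (r 0)"
  have u: "u \<in> terms n"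
    using f(1)[of "r 1"] by (auto simp: u_def terms_def in_keys_iff lookup_minus)
  have "Poly_Mapping.lookup (f (r 1)) v = Poly_Mapping.lookup (f (r 0)) v + Poly_Mapping.lookup u v"
    for v
  proof (cases "v \<in> X ` {..<n}")
    case True
    show ?thesis
      using monoD[OF r(2)[OF True], of 0 1] by (simp add: u_def lookup_minus)
  next
    case False
    then have "Poly_Mapping.lookup (f i) v = 0" for i
      using f(1)[of i] by (auto simp: terms_def in_keys_iff)
    then show ?thesis by (simp add: u_def lookup_minus)
  qed
  then have "f (r 1) = f (r 0) + u"
    by (intro poly_mapping_eqI) (simp add: lookup_add)
  then have "(f (r 0), f (r 1)) \<in> \<sigma>"
    using term_ordering_le_add[OF \<sigma> f(1) u, of "r 0"] by simp
  moreover have "less_term \<sigma> (f (r 1)) (f (r 0))"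
    using desc strict_monoD[OF r(1), of 0 1] by simp
  ultimately show False
    using term_ordering_antisym[OF \<sigma>] by (auto simp: less_term_def)
qed

lemma keys_split:
  fixes m :: pp
  assumes "Poly_Mapping.keys m \<subseteq> V \<union> W"
  shows "\<exists>a b. m = a + b \<and> Poly_Mapping.keys a \<subseteq> V \<and> Poly_Mapping.keys b \<subseteq> W"
  using assms
proof (induction m rule: pp_induct)
  case zero
  show ?case by (intro exI[of _ 0]) simp
next
  case (add v m)
  then obtain a b where ab: "m = a + b" "Poly_Mapping.keys a \<subseteq> V" "Poly_Mapping.keys b \<subseteq> W"
    by blast
  let ?v = "Poly_Mapping.single v (1::nat)"
  consider "v \<in> V" | "v \<in> W" using add.hyps by blast
  then show ?case
  proof cases
    case 1
    then have "Poly_Mapping.keys (?v + a) \<subseteq> V"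
      using ab(2) Poly_Mapping.keys_add[of ?v a] by auto
    then show ?thesis
      using ab by (intro exI[of _ "?v + a"] exI[of _ b]) (simp add: add.assoc)
  next
    case 2
    then have "Poly_Mapping.keys (?v + b) \<subseteq> W"
      using ab(3) Poly_Mapping.keys_add[of ?v b] by auto
    then show ?thesis
      using ab by (intro exI[of _ a] exI[of _ "?v + b"]) (simp add: ac_simps)
  qed
qed

locale order_ideal_labelling =
  fixes n :: nat and T :: "pp set" and ts bs :: "pp list"
  assumes order_ideal: "order_ideal n T"
    and distinct_ts: "distinct ts" and set_ts: "set ts = T"
    and distinct_bs: "distinct bs" and set_bs: "set bs = border n T"
begin

lemma T_terms: "t \<in> T \<Longrightarrow> t \<in> terms n"
  using order_ideal by (auto simp: order_ideal_def)

lemma order_ideal_divisor: "s \<in> terms n \<Longrightarrow> u \<in> terms n \<Longrightarrow> s + u \<in> T \<Longrightarrow> s \<in> T"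
  using order_ideal unfolding order_ideal_def by blast

lemma ts_mem [simp]: "i < length ts \<Longrightarrow> ts ! i \<in> T"
  using set_ts by auto

lemma ts_terms: "i < length ts \<Longrightarrow> ts ! i \<in> terms n"
  by (simp add: T_terms)

lemma zero_in_T: "0 \<in> T"
proof -
  obtain t where t: "t \<in> T" using order_ideal by (auto simp: order_ideal_def)
  have "0 \<in> terms n" by (simp add: terms_def)
  moreover have "0 + t \<in> T" using t by simp
  ultimately show ?thesis using order_ideal_divisor[OF _ T_terms[OF t]] by blast
qed

lemma bs_cases:
  assumes "j < length bs"
  obtains k t where "k < n" "t \<in> T" "bs ! j = xvar k + t"
proof -
  have "bs ! j \<in> border n T" using nth_mem[OF assms] by (simp only: set_bs)
  then obtain k where "k < n" "bs ! j \<in> (\<lambda>t. xvar k + t) ` T"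
    unfolding border_def by blast
  then obtain t where "t \<in> T" "bs ! j = xvar k + t" by blast
  then show ?thesis by (rule that[OF \<open>k < n\<close>])
qed

lemma bs_terms: "j < length bs \<Longrightarrow> bs ! j \<in> terms n"
  by (erule bs_cases) (simp add: terms_add xvar_in_terms T_terms)

lemma bs_notin: "j < length bs \<Longrightarrow> bs ! j \<notin> T"
  using nth_mem[of j bs] by (simp add: set_bs border_def)

lemma cvar_in_A [simp]:
  "i < length ts \<Longrightarrow> j < length bs \<Longrightarrow> cvar i j \<in> polys (c_indets ts bs)"
  by (auto simp: c_indets_def)

lemma mon_in_polys_x [simp]: "t \<in> terms n \<Longrightarrow> mon t \<in> polys (x_indets n \<union> V)"
  by (rule mon_in_polys) (auto simp: terms_def x_indets_def)

lemma Sc_sub: "\<eta> \<le> length bs \<Longrightarrow> Sc_indets \<sigma> ts bs \<eta> \<subseteq> c_indets ts bs"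
  by (auto simp: Sc_indets_def S_indets_def c_indets_def)

lemma star_prebasis_in_polys:
  assumes "j < \<eta>" "\<eta> \<le> length bs"
  shows "star_prebasis \<sigma> ts bs j \<in> polys (x_indets n \<union> Sc_indets \<sigma> ts bs \<eta>)"
  using assms unfolding star_prebasis_def
  by (intro polys_diff polys_sum polys_mult cvar_in_polys mon_in_polys_x)
    (auto simp: bs_terms ts_terms Sc_indets_def S_indets_def)

lemma border_prebasis_in_polys:
  assumes "j < length bs"
  shows "border_prebasis ts bs j \<in> polys (x_indets n \<union> c_indets ts bs)"
  using assms unfolding border_prebasis_def
  by (intro polys_diff polys_sum polys_mult cvar_in_polys mon_in_polys_x)
    (auto simp: bs_terms ts_terms c_indets_def)

text \<open>
  \<open>Z\<close> is an arbitrary ideal containing the polynomials $g_j^*$, because the lemma is used both for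
  the ideal defining $U_{\mathcal{O},\sigma}$ and for the contraction of the one defining
  $U_{\mathcal{O}}$.
\<close>

lemma division:
  fixes Z :: "'a::field mpoly set"
  assumes \<sigma>: "term_ordering n \<sigma>" and \<eta>: "\<eta> \<le> length bs"
    and corners: "monoid_ideal n (set (take \<eta> bs)) = terms n - T"
    and Z: "ideal Z (poly_ring (x_indets n \<union> Sc_indets \<sigma> ts bs \<eta>))"
    and star: "\<And>j. j < \<eta> \<Longrightarrow> star_prebasis \<sigma> ts bs j \<in> Z"
    and f: "f \<in> polys (x_indets n \<union> Sc_indets \<sigma> ts bs \<eta>)"
  obtains a where "\<And>i. i < length ts \<Longrightarrow> a i \<in> polys (Sc_indets \<sigma> ts bs \<eta>)"
    and "f - (\<Sum>i<length ts. a i * mon (ts ! i)) \<in> Z"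
proof -
  let ?V = "Sc_indets \<sigma> ts bs \<eta>"
  define D :: "'a mpoly set" where "D = {f. \<exists>a. (\<forall>i<length ts. a i \<in> polys ?V) \<and>
    f - (\<Sum>i<length ts. a i * mon (ts ! i)) \<in> Z}"
  have mono: "polys ?V \<subseteq> (polys (x_indets n \<union> ?V) :: 'a mpoly set)"
    by (rule polys_mono) simp
  have D_add: "p + q \<in> D" if "p \<in> D" "q \<in> D" for p q
  proof -
    from that obtain a b where
      a: "\<forall>i<length ts. a i \<in> polys ?V" "p - (\<Sum>i<length ts. a i * mon (ts ! i)) \<in> Z" and
      b: "\<forall>i<length ts. b i \<in> polys ?V" "q - (\<Sum>i<length ts. b i * mon (ts ! i)) \<in> Z"
      unfolding D_def by blast
    have "p + q - (\<Sum>i<length ts. (a i + b i) * mon (ts ! i)) =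
      (p - (\<Sum>i<length ts. a i * mon (ts ! i))) + (q - (\<Sum>i<length ts. b i * mon (ts ! i)))"
      by (simp add: distrib_right sum.distrib)
    then have "p + q - (\<Sum>i<length ts. (a i + b i) * mon (ts ! i)) \<in> Z"
      using ideal_add[OF Z a(2) b(2)] by (simp only:)
    then show ?thesis
      using a(1) b(1) unfolding D_def by (intro CollectI exI[of _ "\<lambda>i. a i + b i"] conjI) auto
  qed
  have D_mult: "c * p \<in> D" if "p \<in> D" "c \<in> polys ?V" for c p
  proof -
    from that obtain a where
      a: "\<forall>i<length ts. a i \<in> polys ?V" "p - (\<Sum>i<length ts. a i * mon (ts ! i)) \<in> Z"
      unfolding D_def by blast
    have "c * p - (\<Sum>i<length ts. (c * a i) * mon (ts ! i)) =
      c * (p - (\<Sum>i<length ts. a i * mon (ts ! i)))"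
      by (simp add: right_diff_distrib sum_distrib_left mult.assoc)
    then have "c * p - (\<Sum>i<length ts. (c * a i) * mon (ts ! i)) \<in> Z"
      using ideal_mult[OF Z subsetD[OF mono that(2)] a(2)] by (simp only:)
    then show ?thesis
      using a(1) that(2) unfolding D_def by (intro CollectI exI[of _ "\<lambda>i. c * a i"] conjI) auto
  qed
  have D_Z: "p \<in> D" if "p \<in> Z" for p
    using that unfolding D_def by (auto intro!: exI[of _ "\<lambda>_. 0"])
  have D_sum: "sum h I \<in> D" if "\<And>i. i \<in> I \<Longrightarrow> h i \<in> D" for h :: "nat \<Rightarrow> 'a mpoly" and I
    using that
    by (induction I rule: infinite_finite_induct) (simp_all add: D_add D_Z[OF ideal_zero[OF Z]])
  have D_mon: "mon t \<in> D" if "t \<in> terms n" for t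
    using wf_term_ordering[OF \<sigma>] that
  proof (induction t rule: wf_induct_rule)
    case (less t)
    show ?case
    proof (cases "t \<in> T")
      case True
      then obtain m where m: "m < length ts" "ts ! m = t"
        using set_ts by (auto simp: in_set_conv_nth)
      have "(\<Sum>i<length ts. (if i = m then 1 else 0) * mon (ts ! i)) = (mon t :: 'a mpoly)"
        using m by (simp add: if_distrib[of "\<lambda>c. c * _"] cong: if_cong)
      then show ?thesis
        using ideal_zero[OF Z] unfolding D_def by (auto intro!: exI[of _ "\<lambda>i. if i = m then 1 else 0"])
    next
      case False
      then have "t \<in> monoid_ideal n (set (take \<eta> bs))"
        using corners less.prems by simp
      then obtain j u where j: "j < \<eta>" "t = bs ! j + u" "u \<in> terms n"
        using \<eta> by (auto simp: monoid_ideal_def in_set_conv_nth)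
      then have jb: "j < length bs" using \<eta> by simp
      \<comment> \<open>Reduction of \<open>t\<close> by the corner \<open>bs ! j\<close>: every term that it produces is smaller than \<open>t\<close>.\<close>
      let ?I = "{i. i < length ts \<and> less_term \<sigma> (ts ! i) (bs ! j)}"
      have "mon t = mon u * star_prebasis \<sigma> ts bs j
          + (\<Sum>i\<in>?I. cvar i j * (mon (ts ! i + u) :: 'a mpoly))"
        by (simp add: star_prebasis_def j(2) right_diff_distrib sum_distrib_left mon_def
            mult_single ac_simps mult.left_commute[of "Poly_Mapping.single u 1"])
      moreover have "mon u * star_prebasis \<sigma> ts bs j \<in> Z"
        using j by (intro ideal_mult[OF Z] star) simp_all
      moreover have "(\<Sum>i\<in>?I. cvar i j * (mon (ts ! i + u) :: 'a mpoly)) \<in> D"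
      proof (intro D_sum D_mult)
        fix i assume i: "i \<in> ?I"
        then have "less_term \<sigma> (ts ! i + u) t"
          unfolding j(2) using j(3) jb by (intro less_term_add[OF \<sigma>]) (auto simp: ts_terms bs_terms)
        moreover have "ts ! i + u \<in> terms n"
          using i j(3) by (simp add: terms_add ts_terms)
        ultimately show "(mon (ts ! i + u) :: 'a mpoly) \<in> D"
          using less by blast
        show "cvar i j \<in> polys ?V"
          using i j(1) jb by (intro cvar_in_polys) (auto simp: Sc_indets_def S_indets_def)
      qed
      ultimately show ?thesis using D_add[OF D_Z] by simp
    qed
  qed
  have "f \<in> D"
    using f
  proof (induction f rule: poly_induct)
    case (single m c)
    then obtain a b where ab: "m = a + b" "Poly_Mapping.keys a \<subseteq> x_indets n" "Poly_Mapping.keys b \<subseteq> ?V"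
      using keys_split by blast
    have "Poly_Mapping.single m c = Poly_Mapping.single b c * mon a"
      by (simp add: ab(1) mon_def mult_single add.commute)
    moreover have "Poly_Mapping.single b c * mon a \<in> D"
      using ab by (intro D_mult D_mon single_in_polys) (auto simp: terms_def x_indets_def)
    ultimately show ?case by simp
  qed (rule D_add)
  then show ?thesis using that unfolding D_def by blast
qed


end

section \<open>Independence of the order ideal modulo the border prebasis\<close>

text \<open>
  A power product of the mixed ring is a coefficient part in the indeterminates \<open>C i j\<close> times a term
  in the indeterminates \<open>X k\<close>. The latter acts on vectors through the multiplication matrices, the
  former as a scalar.
\<close>

definition c_part :: "pp \<Rightarrow> pp" where
  "c_part = Poly_Mapping.mapp (\<lambda>v e. case v of X _ \<Rightarrow> 0 | C _ _ \<Rightarrow> e)"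

lemma lookup_c_part:
  "Poly_Mapping.lookup (c_part m) v = (case v of X _ \<Rightarrow> 0 | C _ _ \<Rightarrow> Poly_Mapping.lookup m v)"
  by (auto simp: c_part_def lookup_mapp when_def in_keys_iff split: indet.split)

lemma c_part_add: "c_part (a + b) = c_part a + c_part b"
  by (intro poly_mapping_eqI) (simp add: lookup_c_part lookup_add split: indet.split)

lemma c_part_terms: "t \<in> terms n \<Longrightarrow> c_part t = 0"
  by (intro poly_mapping_eqI) (auto simp: lookup_c_part terms_def in_keys_iff split: indet.split)

lemma c_part_id: "Poly_Mapping.keys m \<subseteq> c_indets ts bs \<Longrightarrow> c_part m = m"
  by (intro poly_mapping_eqI) (auto simp: lookup_c_part c_indets_def in_keys_iff split: indet.split)

lemma keys_c_part:
  "Poly_Mapping.keys m \<subseteq> x_indets n \<union> c_indets ts bs \<Longrightarrow> Poly_Mapping.keys (c_part m) \<subseteq> c_indets ts bs"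
  by (intro subsetI) (auto simp: in_keys_iff lookup_c_part x_indets_def subset_iff split: indet.splits)

lemma index_of_nth: "distinct us \<Longrightarrow> m < length us \<Longrightarrow> index_of us (us ! m) = m"
  unfolding index_of_def by (auto simp: nth_eq_iff_index_eq)

definition mat_act :: "pp list \<Rightarrow> pp list \<Rightarrow> nat \<Rightarrow> (nat \<Rightarrow> 'a::field mpoly) \<Rightarrow> nat \<Rightarrow> 'a mpoly" where
  "mat_act ts bs k v i = (\<Sum>j<length ts. mult_matrix ts bs k $$ (i, j) * v j)"

text \<open>
  The action of $\mathcal{A}_{k-1}^{\alpha_{k-1}} \cdots \mathcal{A}_0^{\alpha_0}$, where $\alpha$ are
  the exponents of the indeterminates \<open>X 0\<close>, \<open>X 1\<close>, \<open>\<dots>\<close> in the given power product. As the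
  matrices do not commute in the polynomial ring itself, an order of the factors has to be chosen;
  modulo the commutators it is immaterial.
\<close>

primrec term_act ::
  "pp list \<Rightarrow> pp list \<Rightarrow> nat \<Rightarrow> pp \<Rightarrow> (nat \<Rightarrow> 'a::field mpoly) \<Rightarrow> nat \<Rightarrow> 'a mpoly" where
  "term_act ts bs 0 m v = v"
| "term_act ts bs (Suc k) m v =
     (mat_act ts bs k ^^ Poly_Mapping.lookup m (X k)) (term_act ts bs k m v)"

lemma mat_act_scale: "mat_act ts bs k (\<lambda>i. a * v i) = (\<lambda>i. a * mat_act ts bs k v i)"
  by (simp add: fun_eq_iff mat_act_def sum_distrib_left mult.left_commute)

lemma mat_act_add:
  "mat_act ts bs k (\<lambda>i. v i + w i) = (\<lambda>i. mat_act ts bs k v i + mat_act ts bs k w i)"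
  by (simp add: fun_eq_iff mat_act_def distrib_left sum.distrib)

lemma term_act_scale: "term_act ts bs k m (\<lambda>i. a * v i) = (\<lambda>i. a * term_act ts bs k m v i)"
proof (induction k)
  case (Suc k)
  have "(mat_act ts bs k ^^ e) (\<lambda>i. a * w i) = (\<lambda>i. a * (mat_act ts bs k ^^ e) w i)" for e w
    by (induction e) (simp_all add: mat_act_scale)
  then show ?case by (simp add: Suc.IH)
qed simp

lemma term_act_add:
  "term_act ts bs k m (\<lambda>i. v i + w i) = (\<lambda>i. term_act ts bs k m v i + term_act ts bs k m w i)"
proof (induction k)
  case (Suc k)
  have "(mat_act ts bs k ^^ e) (\<lambda>i. v i + w i) =
    (\<lambda>i. (mat_act ts bs k ^^ e) v i + (mat_act ts bs k ^^ e) w i)" for e v w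
    by (induction e) (simp_all add: mat_act_add)
  then show ?case by (simp add: Suc.IH)
qed simp

lemma term_act_no_x:
  assumes "\<And>l. l < k \<Longrightarrow> Poly_Mapping.lookup m (X l) = 0"
  shows "term_act ts bs k m v = v"
  using assms by (induction k) auto

lemma mult_matrix_carrier: "mult_matrix ts bs k \<in> carrier_mat (length ts) (length ts)"
  by (simp add: mult_matrix_def)

lemma commutator_entry:
  fixes A B :: "'r::comm_ring_1 mat"
  assumes A: "A \<in> carrier_mat m m" and B: "B \<in> carrier_mat m m" and ij: "i < m" "j < m"
  shows "(A * B - B * A) $$ (i, j) = (\<Sum>r<m. A $$ (i, r) * B $$ (r, j)) - (\<Sum>r<m. B $$ (i, r) * A $$ (r, j))"
proof -
  have mult: "(C * D) $$ (i, j) = (\<Sum>r<m. C $$ (i, r) * D $$ (r, j))"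
    if "C \<in> carrier_mat m m" "D \<in> carrier_mat m m" for C D :: "'r mat"
    using that ij by (simp add: scalar_prod_def atLeast0LessThan)
  have "(A * B - B * A) $$ (i, j) = (A * B) $$ (i, j) - (B * A) $$ (i, j)"
    using A B ij by (intro index_minus_mat(1)) simp_all
  then show ?thesis using mult[OF A B] mult[OF B A] by simp
qed

context order_ideal_labelling
begin

lemma mult_matrix_entry:
  assumes "i < length ts" "j < length ts"
  shows "mult_matrix ts bs k $$ (i, j) = (let u = xvar k + ts ! j in
     if u \<in> set ts then (if i = index_of ts u then 1 else 0) else cvar i (index_of bs u))"
  using assms by (simp add: mult_matrix_def)

lemma mult_matrix_in_A:
  assumes "k < n" "i < length ts" "j < length ts"
  shows "mult_matrix ts bs k $$ (i, j) \<in> polys (c_indets ts bs)"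
proof (cases "xvar k + ts ! j \<in> set ts")
  case False
  moreover have "xvar k + ts ! j \<in> (\<lambda>t. xvar k + t) ` T"
    using assms(3) by simp
  ultimately have "xvar k + ts ! j \<in> set bs"
    using assms(1) unfolding set_bs set_ts border_def by blast
  then obtain m where m: "m < length bs" "bs ! m = xvar k + ts ! j"
    by (auto simp: in_set_conv_nth)
  have "index_of bs (xvar k + ts ! j) = m"
    using index_of_nth[OF distinct_bs m(1)] m(2) by simp
  then show ?thesis
    using False m(1) assms by (simp add: mult_matrix_entry)
qed (simp add: mult_matrix_entry assms)

lemma commutator_gens_in_A:
  "{(mult_matrix ts bs k * mult_matrix ts bs l - mult_matrix ts bs l * mult_matrix ts bs k) $$ (i, j)
    | k l i j. k < l \<and> l < n \<and> i < length ts \<and> j < length ts}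
   \<subseteq> (polys (c_indets ts bs) :: 'a::field mpoly set)" (is "?G \<subseteq> ?A")
proof
  fix p assume "p \<in> ?G"
  then obtain k l i j where p: "p = (mult_matrix ts bs k * mult_matrix ts bs l
      - mult_matrix ts bs l * mult_matrix ts bs k) $$ (i, j)"
    and ind: "k < l" "l < n" "i < length ts" "j < length ts"
    by blast
  show "p \<in> ?A"
    unfolding p commutator_entry[OF mult_matrix_carrier mult_matrix_carrier ind(3,4)]
    using ind by (intro polys_diff polys_sum polys_mult mult_matrix_in_A) simp_all
qed

lemma ideal_ideal_B: "ideal (ideal_B n ts bs) (poly_ring (c_indets ts bs))"
  unfolding ideal_B_def by (rule ring.genideal_ideal[OF ring_poly_ring commutator_gens_in_A])

end

text \<open>
  The ideal \<open>J\<close> stands for $I(\mathbb{B}_{\mathcal{O}})$ or for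
  $L_{\mathcal{O},\sigma} + I(\mathbb{B}_{\mathcal{O}})$. Vectors are functions of which only the
  entries below \<open>length ts\<close> matter. Calculations use vectors over $K[\mathbf{c}]$ and a congruence
  in place of vectors over the quotient ring.
\<close>

locale commuting_quotient = order_ideal_labelling +
  fixes J :: "'a::field mpoly set"
  assumes ideal_J: "ideal J (poly_ring (c_indets ts bs))"
    and B_sub_J: "ideal_B n ts bs \<subseteq> J"
begin

abbreviation A where "A \<equiv> (polys (c_indets ts bs) :: 'a mpoly set)"
abbreviation Ax where "Ax \<equiv> (polys (x_indets n \<union> c_indets ts bs) :: 'a mpoly set)"
abbreviation \<mu> where "\<mu> \<equiv> length ts"
abbreviation M where "M k \<equiv> (mult_matrix ts bs k :: 'a mpoly mat)"
abbreviation act where "act k \<equiv> (mat_act ts bs k :: (nat \<Rightarrow> 'a mpoly) \<Rightarrow> _)"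
abbreviation tact where "tact k m \<equiv> (term_act ts bs k m :: (nat \<Rightarrow> 'a mpoly) \<Rightarrow> _)"

definition vecs :: "(nat \<Rightarrow> 'a mpoly) set" where
  "vecs = {v. \<forall>i<\<mu>. v i \<in> A}"

definition veq :: "(nat \<Rightarrow> 'a mpoly) \<Rightarrow> (nat \<Rightarrow> 'a mpoly) \<Rightarrow> bool" (infix \<open>\<approx>\<close> 50) where
  "v \<approx> w \<longleftrightarrow> (\<forall>i<\<mu>. v i - w i \<in> J)"

lemma vecsD: "v \<in> vecs \<Longrightarrow> i < \<mu> \<Longrightarrow> v i \<in> A"
  by (simp add: vecs_def)

lemma veq_refl [simp]: "v \<approx> v"
  using ideal_zero[OF ideal_J] by (simp add: veq_def)

lemma veq_sym: "v \<approx> w \<Longrightarrow> w \<approx> v"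
  unfolding veq_def using ideal_uminus[OF ideal_J] by (metis minus_diff_eq)

lemma veq_trans [trans]: "u \<approx> v \<Longrightarrow> v \<approx> w \<Longrightarrow> u \<approx> w"
  using ideal_add[OF ideal_J, of "u i - v i" "v i - w i" for i] by (simp add: veq_def)

lemma eq_veq_trans [trans]: "u = v \<Longrightarrow> v \<approx> w \<Longrightarrow> u \<approx> w"
  and veq_eq_trans [trans]: "u \<approx> v \<Longrightarrow> v = w \<Longrightarrow> u \<approx> w"
  by simp_all

lemma veq_add: "v \<approx> w \<Longrightarrow> v' \<approx> w' \<Longrightarrow> (\<lambda>i. v i + v' i) \<approx> (\<lambda>i. w i + w' i)"
  unfolding veq_def using ideal_add[OF ideal_J] by (simp add: add_diff_add)

lemma veq_scale:
  assumes "a \<in> A" "v \<approx> w"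
  shows "(\<lambda>i. a * v i) \<approx> (\<lambda>i. a * w i)"
  using assms ideal_mult[OF ideal_J, of a] by (simp add: veq_def right_diff_distrib[symmetric])

lemma act_vecs: "k < n \<Longrightarrow> v \<in> vecs \<Longrightarrow> act k v \<in> vecs"
  unfolding vecs_def mat_act_def
  by (intro CollectI allI impI polys_sum polys_mult mult_matrix_in_A) simp_all

lemma act_cong:
  assumes "k < n" "v \<approx> w"
  shows "act k v \<approx> act k w"
  unfolding veq_def
proof (intro allI impI)
  fix i assume "i < \<mu>"
  have "act k v i - act k w i = (\<Sum>j<\<mu>. M k $$ (i, j) * (v j - w j))"
    by (simp add: mat_act_def sum_subtractf right_diff_distrib)
  also have "\<dots> \<in> J"
    using assms \<open>i < \<mu>\<close> by (intro ideal_sum[OF ideal_J] ideal_mult[OF ideal_J] mult_matrix_in_A) (auto simp: veq_def)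
  finally show "act k v i - act k w i \<in> J" .
qed

lemma commutator_in_J:
  assumes "k < l" "l < n" "i < \<mu>" "j < \<mu>"
  shows "(M k * M l - M l * M k) $$ (i, j) \<in> J"
proof -
  have "(M k * M l - M l * M k) $$ (i, j) \<in> ideal_B n ts bs"
    unfolding ideal_B_def
    using ring.genideal_self[OF ring_poly_ring commutator_gens_in_A] assms by blast
  then show ?thesis using B_sub_J by blast
qed

lemma act_commute_less:
  assumes "k < l" "l < n" "v \<in> vecs"
  shows "act k (act l v) \<approx> act l (act k v)"
  unfolding veq_def
proof (intro allI impI)
  fix i assume i: "i < \<mu>"
  have comp: "act k (act l v) i = (\<Sum>j<\<mu>. (\<Sum>r<\<mu>. M k $$ (i, r) * M l $$ (r, j)) * v j)" for k l
    unfolding mat_act_def sum_distrib_left sum_distrib_right mult.assoc by (rule sum.swap)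
  have "act k (act l v) i - act l (act k v) i = (\<Sum>j<\<mu>. v j * (M k * M l - M l * M k) $$ (i, j))"
    unfolding comp sum_subtractf[symmetric]
    by (intro sum.cong refl) (simp add: commutator_entry[OF mult_matrix_carrier mult_matrix_carrier i] right_diff_distrib mult.commute
        del: index_minus_mat index_mult_mat)
  also have "\<dots> \<in> J"
    using assms i by (intro ideal_sum[OF ideal_J] ideal_mult[OF ideal_J] commutator_in_J) (auto simp: vecs_def)
  finally show "act k (act l v) i - act l (act k v) i \<in> J" .
qed

lemma act_commute:
  assumes "k < n" "l < n" "v \<in> vecs"
  shows "act k (act l v) \<approx> act l (act k v)"
  using act_commute_less[of k l v] act_commute_less[of l k v] assms
  by (cases k l rule: linorder_cases) (auto intro: veq_sym)

lemma act_pow_vecs: "k < n \<Longrightarrow> v \<in> vecs \<Longrightarrow> (act k ^^ e) v \<in> vecs"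
  by (induction e) (auto intro: act_vecs)

lemma act_pow_cong: "k < n \<Longrightarrow> v \<approx> w \<Longrightarrow> (act k ^^ e) v \<approx> (act k ^^ e) w"
  by (induction e) (auto intro: act_cong)

lemma act_pow_commute:
  assumes "k < n" "l < n" "v \<in> vecs"
  shows "(act k ^^ e) (act l v) \<approx> act l ((act k ^^ e) v)"
proof (induction e)
  case (Suc e)
  have "(act k ^^ Suc e) (act l v) \<approx> act k (act l ((act k ^^ e) v))"
    using act_cong[OF assms(1) Suc.IH] by simp
  also have "\<dots> \<approx> act l (act k ((act k ^^ e) v))"
    using assms by (intro act_commute act_pow_vecs)
  finally show ?case by simp
qed simp

lemma tact_vecs: "k \<le> n \<Longrightarrow> v \<in> vecs \<Longrightarrow> tact k m v \<in> vecs"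
  by (induction k) (auto intro: act_pow_vecs)

lemma tact_cong: "k \<le> n \<Longrightarrow> v \<approx> w \<Longrightarrow> tact k m v \<approx> tact k m w"
  by (induction k) (auto intro: act_pow_cong)

lemma tact_commute:
  assumes "k \<le> n" "l < n" "v \<in> vecs"
  shows "tact k m (act l v) \<approx> act l (tact k m v)"
  using assms
proof (induction k)
  case (Suc k)
  let ?e = "Poly_Mapping.lookup m (X k)"
  have "tact (Suc k) m (act l v) \<approx> (act k ^^ ?e) (act l (tact k m v))"
    using Suc by (simp add: act_pow_cong)
  also have "\<dots> \<approx> act l ((act k ^^ ?e) (tact k m v))"
    using Suc.prems by (intro act_pow_commute tact_vecs) auto
  finally show ?case by simp
qed simp

lemma tact_commute_pow:
  assumes "k \<le> n" "l < n" "v \<in> vecs"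
  shows "tact k m ((act l ^^ e) v) \<approx> (act l ^^ e) (tact k m v)"
proof (induction e)
  case (Suc e)
  have "tact k m ((act l ^^ Suc e) v) \<approx> act l (tact k m ((act l ^^ e) v))"
    using assms by (simp add: tact_commute act_pow_vecs)
  also have "\<dots> \<approx> act l ((act l ^^ e) (tact k m v))"
    by (intro act_cong assms Suc.IH)
  finally show ?case by simp
qed simp

text \<open>
  This is where the vanishing of the commutators is used: modulo \<open>J\<close> the chosen order of the factors
  does not prevent the action from being multiplicative.
\<close>

lemma tact_plus:
  assumes "k \<le> n" "v \<in> vecs"
  shows "tact k (m + m') v \<approx> tact k m (tact k m' v)"
  using assms
proof (induction k)
  case (Suc k)
  let ?a = "Poly_Mapping.lookup m (X k)" and ?b = "Poly_Mapping.lookup m' (X k)"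
  have "tact (Suc k) (m + m') v = (act k ^^ ?a) ((act k ^^ ?b) (tact k (m + m') v))"
    by (simp add: lookup_add funpow_add)
  also have "\<dots> \<approx> (act k ^^ ?a) ((act k ^^ ?b) (tact k m (tact k m' v)))"
    using Suc by (intro act_pow_cong) auto
  also have "\<dots> \<approx> (act k ^^ ?a) (tact k m ((act k ^^ ?b) (tact k m' v)))"
    using Suc.prems by (intro act_pow_cong veq_sym[OF tact_commute_pow] tact_vecs) auto
  finally show ?case by simp
qed simp

lemma tact_xvar:
  assumes "l < k"
  shows "tact k (xvar l) v = act l v"
proof -
  have "tact k (xvar l) v = (if l < k then act l v else v)" for k
    by (induction k) (auto simp: xvar_def lookup_single when_def less_Suc_eq)
  then show ?thesis using assms by simp
qed

definition e_vec :: "nat \<Rightarrow> nat \<Rightarrow> 'a mpoly" where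
  "e_vec j i = (if i = j then 1 else 0)"

definition e_one :: "nat \<Rightarrow> 'a mpoly" where
  "e_one = e_vec (index_of ts 0)"

lemma e_vec_vecs [simp]: "e_vec j \<in> vecs"
  by (simp add: vecs_def e_vec_def)

lemma e_one_vecs [simp]: "e_one \<in> vecs"
  by (simp add: e_one_def)

lemma act_e_vec: "j < \<mu> \<Longrightarrow> act k (e_vec j) i = M k $$ (i, j)"
  by (simp add: mat_act_def e_vec_def if_distrib[of "\<lambda>x. _ * x"] cong: if_cong)

text \<open>
  Every term of \<open>T\<close> can be reached from $1$ by multiplying with one indeterminate at a time without
  leaving \<open>T\<close>, as \<open>T\<close> is closed under divisors; along such a path the columns of the multiplication
  matrices are unit vectors.
\<close>

lemma tact_ts:
  assumes "t \<in> T"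
  shows "tact n t e_one \<approx> e_vec (index_of ts t)"
proof -
  have "Poly_Mapping.keys t \<subseteq> X ` {..<n}"
    using T_terms[OF assms] by (simp add: terms_def)
  then have "t \<in> T \<longrightarrow> tact n t e_one \<approx> e_vec (index_of ts t)"
  proof (induction t rule: pp_induct)
    case zero
    show ?case by (simp add: term_act_no_x e_one_def)
  next
    case (add v t)
    then obtain k where k: "k < n" "v = X k" by auto
    show ?case
    proof
      assume vt: "Poly_Mapping.single v 1 + t \<in> T"
      have t: "t \<in> terms n" using add.hyps by (simp add: terms_def)
      have xk: "Poly_Mapping.single v 1 = xvar k" by (simp add: k xvar_def)
      have "t \<in> T"
        using order_ideal_divisor[OF t xvar_in_terms[OF k(1)]] vt
        by (simp only: xk add.commute[of t])
      obtain j where j: "j < \<mu>" "ts ! j = t"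
        using \<open>t \<in> T\<close> set_ts by (metis in_set_conv_nth)
      have "tact n (xvar k + t) e_one \<approx> tact n (xvar k) (tact n t e_one)"
        by (rule tact_plus) simp_all
      also have "\<dots> = act k (tact n t e_one)" using k(1) by (rule tact_xvar)
      also have "\<dots> \<approx> act k (e_vec (index_of ts t))"
        using add.IH \<open>t \<in> T\<close> k(1) by (intro act_cong) auto
      also have "index_of ts t = j"
        using index_of_nth[OF distinct_ts j(1)] j(2) by simp
      also have "act k (e_vec j) \<approx> e_vec (index_of ts (xvar k + t))"
        using vt[unfolded xk] j ideal_zero[OF ideal_J]
        by (simp add: veq_def act_e_vec mult_matrix_entry Let_def set_ts xk e_vec_def)
      finally show "tact n (Poly_Mapping.single v 1 + t) e_one \<approx>
          e_vec (index_of ts (Poly_Mapping.single v 1 + t))"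
        by (simp only: xk)
    qed
  qed
  then show ?thesis using assms by blast
qed

lemma tact_ts_nth: "i < \<mu> \<Longrightarrow> tact n (ts ! i) e_one \<approx> e_vec i"
  using tact_ts[OF ts_mem, of i] by (simp add: index_of_nth distinct_ts)

text \<open>
  A border term is an indeterminate times a term of \<open>T\<close>, and the corresponding column of the
  multiplication matrix consists of the coefficients of the generic border prebasis.
\<close>

lemma tact_bs_nth:
  assumes j: "j < length bs"
  shows "tact n (bs ! j) e_one \<approx> (\<lambda>i. cvar i j)"
proof -
  obtain k t where kt: "k < n" "t \<in> T" "bs ! j = xvar k + t"
    using bs_cases[OF j] by blast
  obtain m where m: "m < \<mu>" "ts ! m = t"
    using kt(2) set_ts by (metis in_set_conv_nth)
  have "tact n (bs ! j) e_one \<approx> tact n (xvar k) (tact n t e_one)"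
    unfolding kt(3) by (rule tact_plus) simp_all
  also have "\<dots> = act k (tact n t e_one)" using kt(1) by (rule tact_xvar)
  also have "\<dots> \<approx> act k (e_vec m)"
    using tact_ts_nth[OF m(1)] m(2) kt(1) by (intro act_cong) simp_all
  also have "\<dots> \<approx> (\<lambda>i. cvar i j)"
  proof -
    have "xvar k + t \<notin> set ts" using bs_notin[OF j] by (simp add: kt(3) set_ts)
    moreover have "index_of bs (xvar k + t) = j"
      using index_of_nth[OF distinct_bs j] by (simp add: kt(3))
    ultimately show ?thesis
      using m ideal_zero[OF ideal_J] by (simp add: veq_def act_e_vec mult_matrix_entry Let_def)
  qed
  finally show ?thesis .
qed

text \<open>
  The value $p(\mathcal{A}_0, \dots, \mathcal{A}_{n-1})\, e$, with $e$ the basis vector of the term $1$: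
  modulo \<open>J\<close>, these are the coordinates of \<open>p\<close> with respect to \<open>T\<close>.
\<close>

definition nf :: "'a mpoly \<Rightarrow> nat \<Rightarrow> 'a mpoly" where
  "nf p i = (\<Sum>m\<in>Poly_Mapping.keys p.
     Poly_Mapping.single (c_part m) (Poly_Mapping.lookup p m) * tact n m e_one i)"

lemma nf_single: "nf (Poly_Mapping.single m c) = (\<lambda>i. Poly_Mapping.single (c_part m) c * tact n m e_one i)"
  by (auto simp: nf_def fun_eq_iff)

lemma nf_add: "nf (p + q) = (\<lambda>i. nf p i + nf q i)"
  unfolding nf_def
  by (intro ext setsum_keys_plus_distrib) (simp_all add: single_add distrib_right)

lemma nf_zero: "nf 0 = (\<lambda>_. 0)"
  by (simp add: nf_def fun_eq_iff)

lemma nf_mon: "t \<in> terms n \<Longrightarrow> nf (mon t) = tact n t e_one"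
  by (simp add: mon_def nf_single c_part_terms)

lemma nf_vecs:
  assumes "p \<in> Ax"
  shows "nf p \<in> vecs"
  using assms
proof (induction p rule: poly_induct)
  case (single m c)
  then show ?case
    using vecsD[OF tact_vecs[OF order.refl e_one_vecs]] keys_c_part[OF single]
    by (simp add: nf_single vecs_def)
qed (simp add: nf_add vecs_def)

lemma nf_single_mult:
  assumes "p \<in> Ax" and m: "Poly_Mapping.keys m \<subseteq> x_indets n \<union> c_indets ts bs"
  shows "nf (Poly_Mapping.single m c * p) \<approx> (\<lambda>i. Poly_Mapping.single (c_part m) c * tact n m (nf p) i)"
  using assms(1)
proof (induction p rule: poly_induct)
  case (single m' c')
  let ?c = "Poly_Mapping.single (c_part m + c_part m') (c * c')"
  have "nf (Poly_Mapping.single m c * Poly_Mapping.single m' c') = (\<lambda>i. ?c * tact n (m + m') e_one i)"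
    by (simp add: mult_single nf_single c_part_add)
  also have "\<dots> \<approx> (\<lambda>i. ?c * tact n m (tact n m' e_one) i)"
    using keys_c_part[OF m] keys_c_part[OF single] Poly_Mapping.keys_add[of "c_part m" "c_part m'"]
    by (intro veq_scale tact_plus single_in_polys) auto
  also have "\<dots> = (\<lambda>i. Poly_Mapping.single (c_part m) c * tact n m (nf (Poly_Mapping.single m' c')) i)"
    by (simp add: nf_single term_act_scale mult_single[symmetric] mult.assoc)
  finally show ?case .
next
  case (add p q)
  have "nf (Poly_Mapping.single m c * (p + q)) =
    (\<lambda>i. nf (Poly_Mapping.single m c * p) i + nf (Poly_Mapping.single m c * q) i)"
    by (simp add: distrib_left nf_add)
  also have "\<dots> \<approx> (\<lambda>i. Poly_Mapping.single (c_part m) c * tact n m (nf p) i +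
      Poly_Mapping.single (c_part m) c * tact n m (nf q) i)"
    by (intro veq_add add.IH)
  also have "\<dots> = (\<lambda>i. Poly_Mapping.single (c_part m) c * tact n m (nf (p + q)) i)"
    by (simp add: nf_add term_act_add distrib_left)
  finally show ?case .
qed

lemma nf_scale:
  assumes "a \<in> A" "p \<in> Ax"
  shows "nf (a * p) \<approx> (\<lambda>i. a * nf p i)"
  using assms(1)
proof (induction a rule: poly_induct)
  case (single m c)
  have "tact n m (nf p) = nf p"
    using single by (intro term_act_no_x) (auto simp: c_indets_def in_keys_iff)
  then show ?case
    using nf_single_mult[OF assms(2), of m c] single by (simp add: c_part_id[OF single] le_supI2)
next
  case (add a b)
  show ?case
    using veq_add[OF add.IH] by (simp add: distrib_right nf_add)
qed

lemma nf_linear_combination: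
  assumes "\<And>i. i < \<mu> \<Longrightarrow> a i \<in> A"
  shows "nf (\<Sum>i<\<mu>. a i * mon (ts ! i)) \<approx> a"
proof -
  have "nf (\<Sum>i\<in>I. a i * mon (ts ! i)) \<approx> (\<lambda>l. \<Sum>i\<in>I. a i * e_vec i l)" if "I \<subseteq> {..<\<mu>}" for I
    using finite_subset[OF that finite_lessThan] that
  proof (induction I rule: finite_induct)
    case empty
    show ?case by (simp add: nf_def)
  next
    case (insert i I)
    then have i: "i < \<mu>" by simp
    have "nf (a i * mon (ts ! i)) \<approx> (\<lambda>l. a i * nf (mon (ts ! i)) l)"
      using i assms by (intro nf_scale) (simp_all add: ts_terms)
    also have "\<dots> \<approx> (\<lambda>l. a i * e_vec i l)"
      using i assms by (intro veq_scale) (simp_all add: nf_mon ts_terms tact_ts_nth)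
    finally show ?case
      using insert veq_add[OF _ insert.IH] by (simp add: nf_add)
  qed
  from this[of "{..<\<mu>}"] show ?thesis
    by (simp add: veq_def e_vec_def if_distrib[of "\<lambda>x. _ * x"] cong: if_cong)
qed

definition nf_kernel :: "'a mpoly set" where
  "nf_kernel = {p \<in> Ax. nf p \<approx> (\<lambda>_. 0)}"

lemma ideal_nf_kernel: "ideal nf_kernel (poly_ring (x_indets n \<union> c_indets ts bs))"
proof (rule ideal_poly_ringI)
  show "nf_kernel \<subseteq> Ax" by (auto simp: nf_kernel_def)
  show "0 \<in> nf_kernel" by (simp add: nf_kernel_def nf_zero)
  show nf_kernel_sum: "p + q \<in> nf_kernel" if "p \<in> nf_kernel" "q \<in> nf_kernel" for p q
    using that veq_add[of "nf p" "\<lambda>_. 0" "nf q" "\<lambda>_. 0"] by (simp add: nf_kernel_def nf_add)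
  fix a p assume a: "a \<in> Ax" and p: "p \<in> nf_kernel"
  from a show "a * p \<in> nf_kernel"
  proof (induction a rule: poly_induct)
    case (single m c)
    have "tact n m (\<lambda>_. 0) = (\<lambda>_. 0)"
      using term_act_scale[of ts bs n m 0 "\<lambda>_. 0"] by simp
    then have "tact n m (nf p) \<approx> (\<lambda>_. 0)"
      using tact_cong[of n "nf p" "\<lambda>_. 0" m] p by (simp add: nf_kernel_def)
    then have "(\<lambda>i. Poly_Mapping.single (c_part m) c * tact n m (nf p) i) \<approx>
        (\<lambda>i. Poly_Mapping.single (c_part m) c * 0)"
      using keys_c_part[OF single] by (intro veq_scale single_in_polys)
    with nf_single_mult[OF _ single, of p c] have "nf (Poly_Mapping.single m c * p) \<approx> (\<lambda>_. 0)"
      using p by (auto simp: nf_kernel_def intro: veq_trans)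
    then show ?case using p single by (simp add: nf_kernel_def)
  next
    case (add a b)
    then show ?case
      by (simp add: distrib_right nf_kernel_sum)
  qed
qed

text \<open>
  The independence of \<open>T\<close> over the quotient by \<open>J\<close>: the coordinates of $\sum_i a_i t_i$ are the $a_i$.
\<close>

lemma combination_in_kernel:
  assumes "\<And>i. i < \<mu> \<Longrightarrow> a i \<in> A" "(\<Sum>i<\<mu>. a i * mon (ts ! i)) \<in> nf_kernel" "i < \<mu>"
  shows "a i \<in> J"
proof -
  have "a \<approx> (\<lambda>_. 0)"
    using veq_sym[OF nf_linear_combination[of a, OF assms(1)]] assms(2)
    by (auto simp: nf_kernel_def intro: veq_trans)
  then show ?thesis using assms(3) by (simp add: veq_def)
qed

lemma A_sub_Ax: "A \<subseteq> Ax"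
  by (rule polys_mono) simp

text \<open>
  An element $a$ of the coefficient ring is the combination $a \cdot 1$, and the term $1$ belongs to \<open>T\<close>.
\<close>

lemma kernel_Int_A: "nf_kernel \<inter> A \<subseteq> J"
proof
  fix a assume a: "a \<in> nf_kernel \<inter> A"
  obtain z where z: "z < \<mu>" "ts ! z = 0"
    using zero_in_T set_ts by (metis in_set_conv_nth)
  have "(\<Sum>i<\<mu>. (if i = z then a else 0) * mon (ts ! i)) = a"
    using z by (simp add: if_distrib[of "\<lambda>x. x * _"] mon_def cong: if_cong)
  then show "a \<in> J"
    using combination_in_kernel[of "\<lambda>i. if i = z then a else 0" z] a z(1) by simp
qed

lemma J_sub_kernel: "J \<subseteq> nf_kernel"
proof
  fix p assume p: "p \<in> J"
  then have pA: "p \<in> A" using ideal_sub[OF ideal_J] by blast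
  have "nf (p * 1) \<approx> (\<lambda>i. p * nf 1 i)"
    by (rule nf_scale[OF pA]) simp
  also have "\<dots> \<approx> (\<lambda>_. 0)"
    using ideal_mult[OF ideal_J vecsD[OF nf_vecs[OF polys_one]] p]
    by (simp add: veq_def mult.commute[of p])
  finally show "p \<in> nf_kernel" using pA A_sub_Ax by (auto simp: nf_kernel_def)
qed

lemma border_prebasis_in_kernel:
  assumes j: "j < length bs"
  shows "border_prebasis ts bs j \<in> nf_kernel"
proof -
  let ?s = "\<Sum>i<\<mu>. (- cvar i j) * mon (ts ! i) :: 'a mpoly"
  have g: "border_prebasis ts bs j = mon (bs ! j) + ?s"
    by (simp add: border_prebasis_def sum_negf)
  have "nf ?s \<approx> (\<lambda>i. - cvar i j)"
    using j by (intro nf_linear_combination) simp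
  moreover have "nf (mon (bs ! j)) \<approx> (\<lambda>i. cvar i j)"
    using tact_bs_nth[OF j] by (simp add: nf_mon bs_terms j)
  ultimately have "nf (border_prebasis ts bs j) \<approx> (\<lambda>i. cvar i j + - cvar i j)"
    unfolding g nf_add by (intro veq_add)
  then show ?thesis
    using border_prebasis_in_polys[OF j] by (simp add: nf_kernel_def)
qed

end

section \<open>Comparing the two schemes\<close>

locale corner_labelling = order_ideal_labelling +
  fixes \<sigma> :: "pp rel" and \<eta> :: nat
  assumes ordering: "term_ordering n \<sigma>" and \<eta>_le: "\<eta> \<le> length bs"
    and corners: "monoid_ideal n (set (take \<eta> bs)) = terms n - T"
begin

abbreviation Vc where "Vc \<equiv> c_indets ts bs"
abbreviation Vs where "Vs \<equiv> Sc_indets \<sigma> ts bs \<eta>"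
abbreviation Vxc where "Vxc \<equiv> x_indets n \<union> Vc"
abbreviation Vxs where "Vxs \<equiv> x_indets n \<union> Vs"

lemma Vs_sub: "Vs \<subseteq> Vc"
  using Sc_sub[OF \<eta>_le] .

lemma Vs_c_x: "polys Vs \<subseteq> polys Vc" "polys Vs \<subseteq> polys Vxs" "polys Vc \<subseteq> polys Vxc" "polys Vxs \<subseteq> polys Vxc"
  using Vs_sub by (auto intro!: polys_mono)

lemma L_gens_sub: "{cvar i j | i j. C i j \<in> Vc - S_indets \<sigma> ts bs} \<subseteq> polys Vc"
  by auto

lemma ideal_L_add_B:
  fixes LB :: "'a::field mpoly set"
  defines "LB \<equiv> ideal_L \<sigma> ts bs <+>\<^bsub>poly_ring Vc\<^esub> ideal_B n ts bs"
  shows "ideal LB (poly_ring Vc)" "ideal_B n ts bs \<subseteq> LB"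
    and "\<And>i j. i < length ts \<Longrightarrow> j < length bs \<Longrightarrow> \<not> less_term \<sigma> (ts ! i) (bs ! j) \<Longrightarrow> cvar i j \<in> LB"
proof -
  note gen = sum_of_generated_ideals[OF L_gens_sub commutator_gens_in_A]
  show I: "ideal LB (poly_ring Vc)"
    unfolding LB_def ideal_L_def ideal_B_def by (rule gen(1))
  show "ideal_B n ts bs \<subseteq> LB"
    unfolding ideal_B_def
    by (rule ring.genideal_minimal[OF ring_poly_ring I], unfold LB_def ideal_L_def ideal_B_def)
      (rule gen(3))
  fix i j assume "i < length ts" "j < length bs" "\<not> less_term \<sigma> (ts ! i) (bs ! j)"
  then have "C i j \<in> Vc - S_indets \<sigma> ts bs"
    by (auto simp: c_indets_def S_indets_def)
  then show "cvar i j \<in> LB"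
    unfolding LB_def ideal_L_def ideal_B_def using gen(2) by blast
qed

lemma ideal_B_sub: "ideal_B n ts bs \<subseteq> polys Vxc"
  using ideal_sub[OF ideal_ideal_B] Vs_c_x by blast

lemma ideal_U_facts:
  fixes U :: "'a::field mpoly set"
  defines "U \<equiv> ideal_U n ts bs"
  shows "ideal U (poly_ring Vxc)" "ideal_B n ts bs \<subseteq> U"
    and "border_prebasis ts bs ` {..<length bs} \<subseteq> U"
    and "\<And>I. ideal I (poly_ring Vxc) \<Longrightarrow> ideal_B n ts bs \<subseteq> I \<Longrightarrow>
      border_prebasis ts bs ` {..<length bs} \<subseteq> I \<Longrightarrow> U \<subseteq> I"
  unfolding U_def ideal_U_def Let_def
  using border_prebasis_in_polys by (intro sum_of_generated_ideals ideal_B_sub; blast)+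

lemma ideal_ideal_G: "ideal (ideal_G n \<sigma> ts bs \<eta>) (poly_ring Vs)"
  unfolding ideal_G_def by (rule ideal_Int_polys[OF ideal_L_add_B(1) Vs_sub])

lemma ideal_GU_facts:
  fixes GU :: "'a::field mpoly set"
  defines "GU \<equiv> ideal_GU n \<sigma> ts bs \<eta>"
  shows "ideal GU (poly_ring Vxs)" "ideal_G n \<sigma> ts bs \<eta> \<subseteq> GU"
    and "star_prebasis \<sigma> ts bs ` {..<\<eta>} \<subseteq> GU"
    and "\<And>I. ideal I (poly_ring Vxs) \<Longrightarrow> ideal_G n \<sigma> ts bs \<eta> \<subseteq> I \<Longrightarrow>
      star_prebasis \<sigma> ts bs ` {..<\<eta>} \<subseteq> I \<Longrightarrow> GU \<subseteq> I"
proof -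
  have "ideal_G n \<sigma> ts bs \<eta> \<subseteq> (polys Vxs :: 'a mpoly set)"
    using ideal_sub[OF ideal_ideal_G] Vs_c_x by blast
  moreover have "star_prebasis \<sigma> ts bs ` {..<\<eta>} \<subseteq> (polys Vxs :: 'a mpoly set)"
    using star_prebasis_in_polys[OF _ \<eta>_le] by blast
  ultimately show "ideal GU (poly_ring Vxs)" "ideal_G n \<sigma> ts bs \<eta> \<subseteq> GU"
    "star_prebasis \<sigma> ts bs ` {..<\<eta>} \<subseteq> GU"
    "\<And>I. ideal I (poly_ring Vxs) \<Longrightarrow> ideal_G n \<sigma> ts bs \<eta> \<subseteq> I \<Longrightarrow>
      star_prebasis \<sigma> ts bs ` {..<\<eta>} \<subseteq> I \<Longrightarrow> GU \<subseteq> I"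
    unfolding GU_def ideal_GU_def Let_def by (rule sum_of_generated_ideals)+
qed

lemma
  fixes B :: "'a::field mpoly set"
  defines "B \<equiv> ideal_B n ts bs"
  shows combination_in_U: "(\<And>i. i < length ts \<Longrightarrow> a i \<in> polys Vc) \<Longrightarrow>
      (\<Sum>i<length ts. a i * mon (ts ! i)) \<in> ideal_U n ts bs \<Longrightarrow> i < length ts \<Longrightarrow> a i \<in> B"
    and ideal_U_Int: "ideal_U n ts bs \<inter> polys Vc \<subseteq> B"
proof -
  interpret commuting_quotient n T ts bs B
    unfolding B_def
    by (intro commuting_quotient.intro commuting_quotient_axioms.intro
        order_ideal_labelling_axioms ideal_ideal_B order.refl)
  have U: "ideal_U n ts bs \<subseteq> nf_kernel"
    using border_prebasis_in_kernel J_sub_kernel B_sub_J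
    by (intro ideal_U_facts(4) ideal_nf_kernel) auto
  show "a i \<in> B" if "\<And>i. i < length ts \<Longrightarrow> a i \<in> polys Vc"
    "(\<Sum>i<length ts. a i * mon (ts ! i)) \<in> ideal_U n ts bs" "i < length ts"
    using combination_in_kernel[of a, OF that(1) _ that(3)] that(2) U by blast
  show "ideal_U n ts bs \<inter> polys Vc \<subseteq> B"
    using U kernel_Int_A by blast
qed

text \<open>
  The difference between $g_j^*$ and $g_j$ consists of the terms whose coefficients generate
  $L_{\mathcal{O},\sigma}$.
\<close>

lemma star_prebasis_in_ideal:
  fixes I :: "'a::field mpoly set"
  assumes I: "ideal I (poly_ring Vxc)" and j: "j < length bs"
    and "border_prebasis ts bs j \<in> I"
    and c: "\<And>i. i < length ts \<Longrightarrow> \<not> less_term \<sigma> (ts ! i) (bs ! j) \<Longrightarrow> cvar i j \<in> I"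
  shows "star_prebasis \<sigma> ts bs j \<in> I"
proof -
  let ?N = "{i. i < length ts \<and> \<not> less_term \<sigma> (ts ! i) (bs ! j)}"
    and ?S = "{i. i < length ts \<and> less_term \<sigma> (ts ! i) (bs ! j)}"
  have "{..<length ts} = ?S \<union> ?N" by auto
  then have "(\<Sum>i<length ts. cvar i j * mon (ts ! i)) =
      (\<Sum>i\<in>?S. cvar i j * mon (ts ! i)) + (\<Sum>i\<in>?N. cvar i j * mon (ts ! i) :: 'a mpoly)"
    by (simp only:) (rule sum.union_disjoint; auto)
  then have "star_prebasis \<sigma> ts bs j = border_prebasis ts bs j + (\<Sum>i\<in>?N. mon (ts ! i) * (cvar i j :: 'a mpoly))"
    by (simp add: star_prebasis_def border_prebasis_def mult.commute)
  also have "\<dots> \<in> I"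
    using assms by (intro ideal_add[OF I] ideal_sum[OF I] ideal_mult[OF I] mon_in_polys_x ts_terms c) auto
  finally show ?thesis .
qed

text \<open>
  The map $G_{\mathcal{O},\sigma} \to U_{\mathcal{O},\sigma}$ is injective. Independence is applied
  modulo $L_{\mathcal{O},\sigma} + I(\mathbb{B}_{\mathcal{O}})$, because only there do the $g_j^*$
  vanish together with the $g_j$; the contraction of this ideal is $I(\mathbb{G}_{\mathcal{O},\sigma})$
  by definition.
\<close>

lemma ideal_GU_Int: "ideal_GU n \<sigma> ts bs \<eta> \<inter> polys Vs \<subseteq> (ideal_G n \<sigma> ts bs \<eta> :: 'a::field mpoly set)"
proof -
  let ?LB = "ideal_L \<sigma> ts bs <+>\<^bsub>poly_ring Vc\<^esub> ideal_B n ts bs :: 'a mpoly set"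
  interpret commuting_quotient n T ts bs ?LB
    by (intro commuting_quotient.intro commuting_quotient_axioms.intro
        order_ideal_labelling_axioms ideal_L_add_B)
  have "star_prebasis \<sigma> ts bs j \<in> nf_kernel" if "j < \<eta>" for j
  proof (intro star_prebasis_in_ideal ideal_nf_kernel border_prebasis_in_kernel)
    show j: "j < length bs" using that \<eta>_le by simp
    then show "j < length bs" .
    fix i assume "i < length ts" "\<not> less_term \<sigma> (ts ! i) (bs ! j)"
    then show "cvar i j \<in> nf_kernel"
      using ideal_L_add_B(3)[OF _ j] J_sub_kernel by blast
  qed
  moreover have "ideal_G n \<sigma> ts bs \<eta> \<subseteq> nf_kernel"
    using J_sub_kernel by (auto simp: ideal_G_def)
  ultimately have "ideal_GU n \<sigma> ts bs \<eta> \<subseteq> nf_kernel \<inter> polys Vxs"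
    using Vs_sub ideal_sub[OF ideal_ideal_G] Vs_c_x(2) star_prebasis_in_polys[OF _ \<eta>_le]
    by (intro ideal_GU_facts(4) ideal_Int_polys[OF ideal_nf_kernel]) (auto, blast?)
  then show ?thesis using kernel_Int_A Vs_c_x(1) unfolding ideal_G_def by blast
qed

lemma induces_iso_G_iff:
  "induces_iso (poly_ring Vs :: 'a::field mpoly ring) (ideal_G n \<sigma> ts bs \<eta>)
      (poly_ring Vc :: 'a mpoly ring) (ideal_B n ts bs) (\<lambda>p. p) \<longleftrightarrow>
    ideal_G n \<sigma> ts bs \<eta> \<subseteq> (ideal_B n ts bs :: 'a mpoly set) \<and>
    ideal_B n ts bs \<inter> polys Vs \<subseteq> (ideal_G n \<sigma> ts bs \<eta> :: 'a mpoly set) \<and>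
    (\<forall>s\<in>polys Vc. \<exists>r\<in>polys Vs. s - r \<in> (ideal_B n ts bs :: 'a mpoly set))"
  by (intro induces_iso_inclusion_iff Vs_sub ideal_ideal_G ideal_ideal_B)

lemma induces_iso_GU_iff:
  "induces_iso (poly_ring Vxs :: 'a::field mpoly ring) (ideal_GU n \<sigma> ts bs \<eta>)
      (poly_ring Vxc :: 'a mpoly ring) (ideal_U n ts bs) (\<lambda>p. p) \<longleftrightarrow>
    ideal_GU n \<sigma> ts bs \<eta> \<subseteq> (ideal_U n ts bs :: 'a mpoly set) \<and>
    ideal_U n ts bs \<inter> polys Vxs \<subseteq> (ideal_GU n \<sigma> ts bs \<eta> :: 'a mpoly set) \<and>
    (\<forall>s\<in>polys Vxc. \<exists>r\<in>polys Vxs. s - r \<in> (ideal_U n ts bs :: 'a mpoly set))"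
  using Vs_sub by (intro induces_iso_inclusion_iff ideal_GU_facts ideal_U_facts) auto

text \<open>
  The isomorphism forces $L_{\mathcal{O},\sigma} \subseteq I(\mathbb{B}_{\mathcal{O}})$, so the $g_j^*$
  vanish in $U_{\mathcal{O}}$. For injectivity, an element of the contraction is divided by the $g_j^*$;
  by independence the coefficients of the remainder lie in $I(\mathbb{B}_{\mathcal{O}})$, hence in
  $I(\mathbb{G}_{\mathcal{O},\sigma})$.
\<close>

lemma G_iso_imp_GU_iso:
  assumes "induces_iso (poly_ring Vs :: 'a::field mpoly ring) (ideal_G n \<sigma> ts bs \<eta>)
      (poly_ring Vc :: 'a mpoly ring) (ideal_B n ts bs) (\<lambda>p. p)"
  shows "induces_iso (poly_ring Vxs :: 'a mpoly ring) (ideal_GU n \<sigma> ts bs \<eta>)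
      (poly_ring Vxc :: 'a mpoly ring) (ideal_U n ts bs) (\<lambda>p. p)"
proof -
  let ?B = "ideal_B n ts bs :: 'a mpoly set" and ?G = "ideal_G n \<sigma> ts bs \<eta> :: 'a mpoly set"
  let ?U = "ideal_U n ts bs :: 'a mpoly set" and ?GU = "ideal_GU n \<sigma> ts bs \<eta> :: 'a mpoly set"
  from assms have GB: "?G \<subseteq> ?B" and BG: "?B \<inter> polys Vs \<subseteq> ?G"
    and surj: "\<And>s. s \<in> polys Vc \<Longrightarrow> \<exists>r\<in>polys Vs. s - r \<in> ?B"
    unfolding induces_iso_G_iff by auto
  note U = ideal_U_facts(1-3)[where 'a = 'a] and GU = ideal_GU_facts(1-3)[where 'a = 'a]
  (* Such an indeterminate is congruent to some r in the small ring; then r lies in the contraction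
     of L + B, that is in G, hence in B. *)
  have L: "cvar i j \<in> ?B" if "i < length ts" "j < length bs" "\<not> less_term \<sigma> (ts ! i) (bs ! j)" for i j
  proof -
    have c: "(cvar i j :: 'a mpoly) \<in> polys Vc" using that by simp
    then obtain r where r: "r \<in> polys Vs" "cvar i j - r \<in> ?B" using surj by blast
    have "r \<in> ?G"
      using ideal_diff[OF ideal_L_add_B(1) ideal_L_add_B(3)[OF that] subsetD[OF ideal_L_add_B(2) r(2)]]
        r(1) by (simp add: ideal_G_def)
    then have "r \<in> ?B" using GB by blast
    then show ?thesis using ideal_add[OF ideal_ideal_B r(2) \<open>r \<in> ?B\<close>] by simp
  qed
  have star: "star_prebasis \<sigma> ts bs j \<in> ?U" if "j < \<eta>" for j
    using that \<eta>_le U L by (intro star_prebasis_in_ideal) auto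
  have "?GU \<subseteq> ?U \<inter> polys Vxs"
  proof (rule ideal_GU_facts(4))
    show "ideal (?U \<inter> polys Vxs) (poly_ring Vxs)"
      using Vs_sub by (intro ideal_Int_polys[OF U(1)]) auto
    show "?G \<subseteq> ?U \<inter> polys Vxs"
      using GB U(2) ideal_sub[OF ideal_ideal_G] Vs_c_x(2) by blast
    show "star_prebasis \<sigma> ts bs ` {..<\<eta>} \<subseteq> ?U \<inter> polys Vxs"
      using star star_prebasis_in_polys[OF _ \<eta>_le] by auto
  qed
  then have GU_U: "?GU \<subseteq> ?U" by blast
  moreover have "?U \<inter> polys Vxs \<subseteq> ?GU"
  proof
    fix f assume f: "f \<in> ?U \<inter> polys Vxs"
    obtain a where a: "\<And>i. i < length ts \<Longrightarrow> a i \<in> polys Vs"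
      "f - (\<Sum>i<length ts. a i * mon (ts ! i)) \<in> ?GU"
      by (rule division[OF ordering \<eta>_le corners GU(1), of f]) (use GU(3) f in auto)
    have comb: "(\<Sum>i<length ts. a i * mon (ts ! i)) \<in> ?U"
      using ideal_diff[OF U(1), of f "f - (\<Sum>i<length ts. a i * mon (ts ! i))"] f a(2) GU_U by auto
    have "a i \<in> ?GU" if "i < length ts" for i
    proof -
      have "a i \<in> ?B"
        using a(1) Vs_c_x(1) by (intro combination_in_U[OF _ comb that]) blast
      then show ?thesis using a(1)[OF that] BG GU(2) by blast
    qed
    then have "(\<Sum>i<length ts. mon (ts ! i) * a i) \<in> ?GU"
      by (intro ideal_sum[OF GU(1)] ideal_mult[OF GU(1)]) (simp_all add: ts_terms)
    then show "f \<in> ?GU"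
      using ideal_cong[OF GU(1) a(2)] by (simp add: mult.commute)
  qed
  moreover have "\<exists>r\<in>polys Vxs. s - r \<in> ?U" if "s \<in> polys Vxc" for s
  proof (rule surjective_from_indets[OF U(1) _ _ that])
    fix v assume "v \<in> Vxc"
    then consider "v \<in> x_indets n" | i j where "v = C i j" "i < length ts" "j < length bs"
      by (auto simp: c_indets_def)
    then show "\<exists>r\<in>polys Vxs. mon (Poly_Mapping.single v 1) - r \<in> ?U"
    proof cases
      case 1
      then show ?thesis
        using ideal_zero[OF U(1)] by (intro bexI[of _ "mon (Poly_Mapping.single v 1)"]) simp_all
    next
      case 2
      obtain r where "r \<in> polys Vs" "cvar i j - r \<in> ?B"
        using surj[of "cvar i j"] 2 by auto
      then show ?thesis using Vs_c_x(2) U(2) unfolding 2(1) cvar_def by blast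
    qed
  qed (use Vs_sub in auto)
  ultimately show ?thesis unfolding induces_iso_GU_iff by blast
qed

text \<open>
  The two ideals of coefficients are recovered by intersecting those of the universal families with
  the coefficient rings. For surjectivity, \<open>s\<close> is congruent to an element of the small mixed ring,
  which division turns into $\sum_i a_i t_i$; comparing the coefficients of the term $1$ gives
  $s \equiv a_z$, where $t_z = 1$.
\<close>

lemma GU_iso_imp_G_iso:
  assumes "induces_iso (poly_ring Vxs :: 'a::field mpoly ring) (ideal_GU n \<sigma> ts bs \<eta>)
      (poly_ring Vxc :: 'a mpoly ring) (ideal_U n ts bs) (\<lambda>p. p)"
  shows "induces_iso (poly_ring Vs :: 'a mpoly ring) (ideal_G n \<sigma> ts bs \<eta>)
      (poly_ring Vc :: 'a mpoly ring) (ideal_B n ts bs) (\<lambda>p. p)"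
proof -
  let ?B = "ideal_B n ts bs :: 'a mpoly set" and ?G = "ideal_G n \<sigma> ts bs \<eta> :: 'a mpoly set"
  let ?U = "ideal_U n ts bs :: 'a mpoly set" and ?GU = "ideal_GU n \<sigma> ts bs \<eta> :: 'a mpoly set"
  from assms have GU_U: "?GU \<subseteq> ?U" and U_GU: "?U \<inter> polys Vxs \<subseteq> ?GU"
    and surj: "\<And>s. s \<in> polys Vxc \<Longrightarrow> \<exists>r\<in>polys Vxs. s - r \<in> ?U"
    unfolding induces_iso_GU_iff by auto
  note U = ideal_U_facts(1-3)[where 'a = 'a] and GU = ideal_GU_facts(1-3)[where 'a = 'a]
  have "?G \<subseteq> ?B"
    using GU(2) GU_U ideal_U_Int ideal_sub[OF ideal_ideal_G] Vs_c_x(1) by blast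
  moreover have "?B \<inter> polys Vs \<subseteq> ?G"
    using U(2) U_GU ideal_GU_Int Vs_c_x(2) by blast
  moreover have "\<exists>r\<in>polys Vs. s - r \<in> ?B" if s: "s \<in> polys Vc" for s
  proof -
    obtain f where f: "f \<in> polys Vxs" "s - f \<in> ?U"
      using surj[of s] s Vs_c_x(3) by blast
    obtain a where a: "\<And>i. i < length ts \<Longrightarrow> a i \<in> polys Vs"
      "f - (\<Sum>i<length ts. a i * mon (ts ! i)) \<in> ?GU"
      by (rule division[OF ordering \<eta>_le corners GU(1), of f]) (use GU(3) f(1) in auto)
    obtain z where z: "z < length ts" "ts ! z = 0"
      using zero_in_T set_ts by (metis in_set_conv_nth)
    define b where "b i = (if i = z then s else 0) - a i" for i
    have "(\<Sum>i<length ts. (if i = z then s else 0) * mon (ts ! i)) = s"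
      using z by (simp add: if_distrib[of "\<lambda>x. x * _"] mon_def cong: if_cong)
    then have "(\<Sum>i<length ts. b i * mon (ts ! i)) = (s - f) + (f - (\<Sum>i<length ts. a i * mon (ts ! i)))"
      by (simp add: b_def left_diff_distrib sum_subtractf)
    also have "\<dots> \<in> ?U"
      using a(2) GU_U by (intro ideal_add[OF U(1)] f(2)) blast
    finally have "b z \<in> ?B"
      using s a(1) Vs_c_x(1) z(1) by (intro combination_in_U) (auto simp: b_def intro!: polys_diff)
    then show ?thesis using a(1)[OF z(1)] by (auto simp: b_def)
  qed
  ultimately show ?thesis unfolding induces_iso_G_iff by blast
qed

lemma ideal_L_zero_iff:
  "ideal_L \<sigma> ts bs = ({0} :: 'a::field mpoly set) \<longleftrightarrow>
    (\<forall>i<length ts. \<forall>j<length bs. less_term \<sigma> (ts ! i) (bs ! j))"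
proof
  assume L: "ideal_L \<sigma> ts bs = ({0} :: 'a mpoly set)"
  show "\<forall>i<length ts. \<forall>j<length bs. less_term \<sigma> (ts ! i) (bs ! j)"
  proof (intro allI impI, rule ccontr)
    fix i j assume "i < length ts" "j < length bs" "\<not> less_term \<sigma> (ts ! i) (bs ! j)"
    then have "C i j \<in> Vc - S_indets \<sigma> ts bs"
      by (auto simp: c_indets_def S_indets_def)
    then have "cvar i j \<in> (ideal_L \<sigma> ts bs :: 'a mpoly set)"
      unfolding ideal_L_def using ring.genideal_self[OF ring_poly_ring L_gens_sub] by blast
    then show False using L cvar_nonzero by auto
  qed
next
  assume "\<forall>i<length ts. \<forall>j<length bs. less_term \<sigma> (ts ! i) (bs ! j)"
  then have empty: "{cvar i j | i j. C i j \<in> Vc - S_indets \<sigma> ts bs} = ({} :: 'a mpoly set)"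
    by (auto simp: c_indets_def S_indets_def)
  have "ideal_L \<sigma> ts bs \<subseteq> ({0} :: 'a mpoly set)"
    unfolding ideal_L_def empty
    by (intro ring.genideal_minimal[OF ring_poly_ring] ideal_poly_ringI) auto
  moreover have "0 \<in> (ideal_L \<sigma> ts bs :: 'a mpoly set)"
    unfolding ideal_L_def
    by (intro ideal_zero[OF ring.genideal_ideal[OF ring_poly_ring]] L_gens_sub)
  ultimately show "ideal_L \<sigma> ts bs = ({0} :: 'a mpoly set)" by blast
qed

lemma cornercut_iff:
  "cornercut \<sigma> T (set (take \<eta> bs)) \<longleftrightarrow>
    (\<forall>i<length ts. \<forall>j<length bs. less_term \<sigma> (ts ! i) (bs ! j))"
proof
  assume cc: "cornercut \<sigma> T (set (take \<eta> bs))"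
  show "\<forall>i<length ts. \<forall>j<length bs. less_term \<sigma> (ts ! i) (bs ! j)"
  proof (intro allI impI)
    fix i j assume i: "i < length ts" and j: "j < length bs"
    have "bs ! j \<in> monoid_ideal n (set (take \<eta> bs))"
      using bs_terms[OF j] bs_notin[OF j] corners by simp
    then obtain b u where b: "b \<in> set (take \<eta> bs)" "u \<in> terms n" "bs ! j = b + u"
      by (auto simp: monoid_ideal_def)
    have "b \<in> terms n"
      using b(1) bs_terms by (auto simp: in_set_conv_nth)
    then have "(b, bs ! j) \<in> \<sigma>"
      unfolding b(3) by (intro term_ordering_le_add[OF ordering] b(2))
    moreover have "less_term \<sigma> (ts ! i) b"
      using cc b(1) i by (simp add: cornercut_def)
    ultimately show "less_term \<sigma> (ts ! i) (bs ! j)"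
      using less_term_le_trans[OF ordering] by blast
  qed
next
  assume "\<forall>i<length ts. \<forall>j<length bs. less_term \<sigma> (ts ! i) (bs ! j)"
  then show "cornercut \<sigma> T (set (take \<eta> bs))"
    using \<eta>_le set_ts unfolding cornercut_def by (fastforce simp: in_set_conv_nth)
qed

text \<open>
  Without generators of $L_{\mathcal{O},\sigma}$ only surjectivity is at stake. Division of a border
  term $b_j$ by the $g_j$ that belong to corners yields a second expansion of $b_j$ in terms of
  $\mathcal{O}$, with coefficients in the small ring, and independence identifies it with the one
  given by the generic prebasis.
\<close>

lemma G_iso_if_ideal_L_zero:
  assumes L: "ideal_L \<sigma> ts bs = ({0} :: 'a::field mpoly set)"
  shows "induces_iso (poly_ring Vs :: 'a mpoly ring) (ideal_G n \<sigma> ts bs \<eta>)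
      (poly_ring Vc :: 'a mpoly ring) (ideal_B n ts bs) (\<lambda>p. p)"
proof -
  let ?B = "ideal_B n ts bs :: 'a mpoly set" and ?G = "ideal_G n \<sigma> ts bs \<eta> :: 'a mpoly set"
  let ?U = "ideal_U n ts bs :: 'a mpoly set"
  have less: "less_term \<sigma> (ts ! i) (bs ! j)" if "i < length ts" "j < length bs" for i j
    using L that unfolding ideal_L_zero_iff by blast
  note U = ideal_U_facts(1-3)[where 'a = 'a]
  have G: "?G = ?B \<inter> polys Vs"
    by (simp add: ideal_G_def L set_add_def set_mult_def)
  have Z: "ideal (?U \<inter> polys Vxs) (poly_ring Vxs)"
    using Vs_sub by (intro ideal_Int_polys[OF U(1)]) auto
  have star: "star_prebasis \<sigma> ts bs j \<in> ?U \<inter> polys Vxs" if "j < \<eta>" for j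
  proof
    show "star_prebasis \<sigma> ts bs j \<in> ?U"
      using that \<eta>_le U less by (intro star_prebasis_in_ideal) auto
  qed (rule star_prebasis_in_polys[OF that \<eta>_le])
  have "\<exists>r\<in>polys Vs. s - r \<in> ?B" if "s \<in> polys Vc" for s
  proof (rule surjective_from_indets[OF ideal_ideal_B Vs_sub _ that])
    fix v assume "v \<in> Vc"
    then obtain i j where v: "v = C i j" and ij: "i < length ts" "j < length bs"
      by (auto simp: c_indets_def)
    have b: "mon (bs ! j) \<in> (polys Vxs :: 'a mpoly set)"
      by (simp add: bs_terms ij)
    obtain a where a: "\<And>i. i < length ts \<Longrightarrow> a i \<in> polys Vs"
      "mon (bs ! j) - (\<Sum>i<length ts. a i * mon (ts ! i)) \<in> ?U \<inter> polys Vxs"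
      by (rule division[OF ordering \<eta>_le corners Z _ b]) (use star in auto)
    have "(\<Sum>i<length ts. (cvar i j - a i) * mon (ts ! i)) =
        (mon (bs ! j) - (\<Sum>i<length ts. a i * mon (ts ! i))) - border_prebasis ts bs j"
      by (simp add: border_prebasis_def left_diff_distrib sum_subtractf)
    also have "\<dots> \<in> ?U"
      using a(2) U(3) ij by (intro ideal_diff[OF U(1), of "mon (bs ! j) - _"]) auto
    finally have "cvar i j - a i \<in> ?B"
      using a(1) Vs_c_x(1) ij by (intro combination_in_U[of "\<lambda>i. cvar i j - a i"]) (auto intro!: polys_diff)
    then show "\<exists>r\<in>polys Vs. mon (Poly_Mapping.single v 1) - r \<in> ?B"
      using a(1)[OF ij(1)] unfolding v cvar_def by blast
  qed
  moreover have "?G \<subseteq> ?B" "?B \<inter> polys Vs \<subseteq> ?G" unfolding G by blast+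
  ultimately show ?thesis unfolding induces_iso_G_iff by blast
qed

end

theorem proposition3p11:
  fixes n \<eta> :: nat and T :: "pp set" and \<sigma> :: "pp rel" and ts bs :: "pp list"
  assumes "order_ideal n T"
    and "term_ordering n \<sigma>"
    and "distinct ts" and "set ts = T"
    and "distinct bs" and "set bs = border n T"
    and "\<eta> \<le> length bs" and "minimal_generators n (set (take \<eta> bs)) (terms n - T)"
  defines "a1 \<equiv> induces_iso
      (poly_ring (Sc_indets \<sigma> ts bs \<eta>) :: 'a::field mpoly ring) (ideal_G n \<sigma> ts bs \<eta>)
      (poly_ring (c_indets ts bs) :: 'a mpoly ring) (ideal_B n ts bs) (\<lambda>p. p)"
    and "a2 \<equiv> induces_iso
      (poly_ring (x_indets n \<union> Sc_indets \<sigma> ts bs \<eta>) :: 'a mpoly ring) (ideal_GU n \<sigma> ts bs \<eta>)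
      (poly_ring (x_indets n \<union> c_indets ts bs) :: 'a mpoly ring) (ideal_U n ts bs) (\<lambda>p. p)"
    and "b1 \<equiv> (ideal_L \<sigma> ts bs = ({0} :: 'a mpoly set))"
    and "b2 \<equiv> cornercut \<sigma> T (set (take \<eta> bs))"
  shows "(a1 \<longleftrightarrow> a2) \<and> (b1 \<longleftrightarrow> b2) \<and> (b1 \<longrightarrow> a1)"
proof -
  interpret corner_labelling n T ts bs \<sigma> \<eta>
    using assms(1-8) by unfold_locales (simp_all add: minimal_generators_def)
  have "a1 \<longleftrightarrow> a2"
    unfolding a1_def a2_def using G_iso_imp_GU_iso GU_iso_imp_G_iso by blast
  moreover have "b1 \<longleftrightarrow> b2"
    unfolding b1_def b2_def ideal_L_zero_iff cornercut_iff ..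
  moreover have "b1 \<longrightarrow> a1"
    unfolding a1_def b1_def using G_iso_if_ideal_L_zero by blast
  ultimately show ?thesis by blast
qed

end
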